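(* Let $V$ be a MOSVA and $W$ a $V$-bimodule, both satisfying the pole-order condition, let $n\in\mathbb Z_+$, $u_1,u_2\in V$, and let $f\in\widetilde W_{z_3,\dots,z_{n+2}}$ be such that for every $(z_1,\dots,z_{n+2})\in F_{n+2}\mathbb C$ with $|z_1|>|z_2|>|z_i|$, $i=3,\dots,n+2$, the series $Y_W^L(u_1,z_1)Y_W^L(u_2,z_2)f(z_3,\dots,z_{n+2})$ converges absolutely to a $\overline W$-valued rational function. Then $$Y_W^L(u_1,z_1)Y_W^L(u_2,z_2)f(z_3,\dots,z_{n+2})=Y_W^L(Y_V(u_1,z_1-z_2)u_2,z_2)f(z_3,\dots,z_{n+2})$$ for every $(z_1,\dots,z_{n+2})\in F_{n+2}\mathbb C$ with $|z_1|>|z_2|>|z_1-z_2|+|z_i|$, $i=3,\dots,n+2$. Moreover, $$E(Y_W^L(u_1,z_1)Y_W^L(u_2,z_2)f(z_3,\dots,z_{n+2}))=E(Y_W^L(Y_V(u_1,z_1-z_2)u_2,z_2)f(z_3,\dots,z_{n+2}))$$ as $\overline W$-valued rational functions in $\widetilde W_{z_1,\dots,z_{n+2}}$.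
   Context: All vector spaces are over $\mathbb{C}$; $\mathbb{Z}_+=\{1,2,\dots\}$. **MOSVA.** A meromorphic open-string vertex algebra (MOSVA) is a $\mathbb{Z}$-graded space $V=\coprod_{n\in\mathbb Z}V_{(n)}$, $V_{(n)}=0$ for $n$ sufficiently negative, with a linear map $Y_V:V\otimes V\to V[[x,x^{-1}]]$, $Y_V(u,x)v=\sum_{k\in\mathbb Z}(Y_V)_k(u)v\,x^{-k-1}$, and $\mathbf 1\in V$ such that, with $\mathbf d_Vv=nv$ for $v\in V_{(n)}$, $D_Vv=\lim_{x\to0}\frac{d}{dx}Y_V(v,x)\mathbf 1$ and $V'=\coprod V_{(n)}^*$: (i) $[\mathbf d_V,Y_V(v,x)]=x\frac{d}{dx}Y_V(v,x)+Y_V(\mathbf d_Vv,x)$; (ii) $Y_V(\mathbf 1,x)=1_V$, $Y_V(u,x)\mathbf 1\in V[[x]]$ with constant term $u$; (iii) $\frac{d}{dx}Y_V(v,x)=Y_V(D_Vv,x)=[D_V,Y_V(v,x)]$; (iv) $\langle v',Y_V(u_1,z_1)\cdots Y_V(u_n,z_n)v\rangle$ converges absolutely for $|z_1|>\cdots>|z_n|>0$ to a rational function with only possible poles $z_i=0$, $z_i=z_j$, and $\langle v',Y_V(Y_V(u_1,z_1-z_2)u_2,z_2)v\rangle$ converges absolutely for $|z_2|>|z_1-z_2|>0$ to a rational function with only possible poles $z_1=0,z_2=0,z_1=z_2$; (v) $\langle v',Y_V(u_1,z_1)Y_V(u_2,z_2)v\rangle=\langle v',Y_V(Y_V(u_1,z_1-z_2)u_2,z_2)v\rangle$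 for $|z_1|>|z_2|>|z_1-z_2|>0$. **Bimodules.** A $V$-bimodule is a $\mathbb C$-graded space $W=\coprod_{m\in\mathbb C}W_{[m]}$, $W_{[m]}=0$ for $\mathrm{Re}\,m$ sufficiently negative, with $\mathbf d_Ww=mw$ for $w\in W_{[m]}$, an operator $D_W$ of weight $1$, and linear maps $Y_W^L:V\otimes W\to W[[x,x^{-1}]]$, $Y_W^R:W\otimes V\to W[[x,x^{-1}]]$ such that, with $W'=\coprod W_{[m]}^*$: Left module axioms: $[\mathbf d_W,Y_W^L(u,x)]=Y_W^L(\mathbf d_Vu,x)+x\frac{d}{dx}Y_W^L(u,x)$; $Y_W^L(\mathbf 1,x)=1_W$; $\frac{d}{dx}Y_W^L(u,x)=Y_W^L(D_Vu,x)=[D_W,Y_W^L(u,x)]$; the analogues of (iv), (v) for $\langle w',Y^L_W(u_1,z_1)\cdots Y^L_W(u_n,z_n)w\rangle$ and $\langle w',Y_W^L(Y_V(u_1,z_1-z_2)u_2,z_2)w\rangle$. Right module axioms: $\mathbf d_WY_W^R(w,x)-Y_W^R(w,x)\mathbf d_V=Y_W^R(\mathbf d_Ww,x)+x\frac{d}{dx}Y_W^R(w,x)$; $Y_W^R(w,x)\mathbf 1\in W[[x]]$ with constant term $w$; $\frac{d}{dx}Y_W^R(w,x)=Y_W^R(D_Ww,x)=D_WY_W^R(w,x)-Y_W^R(w,x)D_V$; the analogues of (iv), (v) for $\langle w',Y_W^R(w,z_1)Y_V(u_1,z_2)\cdots Y_V(u_{n-1},z_n)u_n\rangle$ and $\langle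 w',Y_W^R(Y_W^R(w,z_1-z_2)u_1,z_2)u_2\rangle$. Compatibility: $\langle w',Y_W^L(u_1,z_1)\cdots Y_W^L(u_n,z_n)Y_W^R(w,z_{n+1})Y_V(u_{n+1},z_{n+2})\cdots Y_V(u_{n+m-1},z_{n+m})u_{n+m}\rangle$ converges absolutely for $|z_1|>\cdots>|z_{n+m}|>0$ to a rational function; and $\langle w',Y_W^L(u,z_1)Y_W^R(w,z_2)v\rangle$ (for $|z_1|>|z_2|>0$) and $\langle w',Y_W^R(Y_W^L(u,z_1-z_2)w,z_2)v\rangle$ (for $|z_2|>|z_1-z_2|>0$) converge absolutely to a common rational function with only possible poles $z_1=0,z_2=0,z_1=z_2$. Write $Y_W^L(v,x)=\sum_k(Y_W^L)_k(v)x^{-k-1}$. **Pole-order condition.** $V$ satisfies it if for all $u_1,v\in V$ there is $C$ such that for all $v'\in V',u_2\in V$ the pole $z_1=0$ of the rational function of $\langle v',Y_V(u_1,z_1)Y_V(u_2,z_2)v\rangle$ has order $<C$. $W$ satisfies it if the order of the pole $z_1=0$ is bounded for the rational functions of: $\langle w',Y_W^L(u_1,z_1)Y_W^L(u_2,z_2)w\rangle$ (bound depending only on $u_1,w$); $\langle w',Y_W^R(w,z_1)Y_V(u_1,z_2)u_2\rangle$ (only on $u_2,w$); $\langle w',Y_W^L(u_1,z_1)Y_W^R(w,z_2)u_2\rangle$ (only on $u_1,u_2$). **$\overline W$-valued rational functions.** $\overline W=\prod_mW_{[m]}$, paired with $W'$; finite sums of homogeneous operators on $W$ (such as $(Y_W^L)_k(v)$)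 act on $\overline W$ componentwise. $F_n\mathbb C=\{(z_1,\dots,z_n)\in\mathbb C^n:z_i\ne z_j\ (i\neq j)\}$. $\widetilde W_{z_1,\dots,z_n}$ is the space of $\overline W$-valued rational functions, i.e. maps $f:F_n\mathbb C\to\overline W$ such that (1) for each $w'\in W'$, $\langle w',f(z_1,\dots,z_n)\rangle$ is a rational function with only possible poles $z_i=z_j$; (2) there are integers $p_{ij}$ and $g\in W[[x_1,\dots,x_n]]$ with $\prod_{i<j}(z_i-z_j)^{p_{ij}}\langle w',f(z_1,\dots,z_n)\rangle=\langle w',g(z_1,\dots,z_n)\rangle$ as polynomial functions, for all $w'$. **Series.** $Y_W^L(u_1,z_1)Y_W^L(u_2,z_2)f(\cdots)$ denotes the double series $\sum_{k_1,k_2}(Y_W^L)_{k_1}(u_1)(Y_W^L)_{k_2}(u_2)f(\cdots)z_1^{-k_1-1}z_2^{-k_2-1}$ of elements of $\overline W$, and $Y_W^L(Y_V(u_1,z_1-z_2)u_2,z_2)f(\cdots)$ denotes $\sum_{k_1,k_2}(Y_W^L)_{k_2}((Y_V)_{k_1}(u_1)u_2)f(\cdots)(z_1-z_2)^{-k_1-1}z_2^{-k_2-1}$. Such a series converges absolutely if it does so after pairing with every $w'\in W'$; equalities of series at given points are equalities of their sums. If the sum extends to a $\overline W$-valued rational function, $E(\cdot)$ denotes that function. *)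

theory Defs
  imports "HOL-Analysis.Analysis"
begin

section \<open>Graded spaces, graded duals, algebraic completions\<close>

definition homogeneous_decomposition :: "('i \<Rightarrow> 'a::ab_group_add set) \<Rightarrow> 'a \<Rightarrow> ('i \<Rightarrow> 'a) \<Rightarrow> bool" where
  "homogeneous_decomposition gr w c \<longleftrightarrow>
     (\<forall>i. c i \<in> gr i) \<and> finite {i. c i \<noteq> 0} \<and> w = (\<Sum>i | c i \<noteq> 0. c i)"

definition hom_comp :: "('i \<Rightarrow> 'a::ab_group_add set) \<Rightarrow> 'a \<Rightarrow> 'i \<Rightarrow> 'a" where
  "hom_comp gr w = (THE c. homogeneous_decomposition gr w c)"

text \<open>A complex vector space (the whole type) that is the internal direct sum of the subspaces
  \<open>gr i\<close>.\<close>

locale graded_vector_space = vector_space scl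
  for scl :: "complex \<Rightarrow> 'a::ab_group_add \<Rightarrow> 'a" +
  fixes gr :: "'i \<Rightarrow> 'a set"
  assumes subspace_gr: "subspace (gr i)"
    and unique_decomposition: "\<exists>!c. homogeneous_decomposition gr w c"

definition grading_op ::
    "(complex \<Rightarrow> 'a::ab_group_add \<Rightarrow> 'a) \<Rightarrow> ('i \<Rightarrow> complex) \<Rightarrow> ('i \<Rightarrow> 'a set) \<Rightarrow> 'a \<Rightarrow> 'a" where
  "grading_op scl wt gr w = (\<Sum>i | hom_comp gr w i \<noteq> 0. scl (wt i) (hom_comp gr w i))"

text \<open>The coproduct of the duals of the \<open>gr i\<close>, realized as the linear functionals on the whole
  space that vanish on all but finitely many \<open>gr i\<close>.\<close>

definition graded_dual ::
    "(complex \<Rightarrow> 'a::ab_group_add \<Rightarrow> 'a) \<Rightarrow> ('i \<Rightarrow> 'a set) \<Rightarrow> ('a \<Rightarrow> complex) set" where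
  "graded_dual scl gr =
     {\<phi>. Vector_Spaces.linear scl (*) \<phi> \<and> finite {i. \<exists>w\<in>gr i. \<phi> w \<noteq> 0}}"

definition completion :: "('i \<Rightarrow> 'a set) \<Rightarrow> ('i \<Rightarrow> 'a) set" where
  "completion gr = {x. \<forall>i. x i \<in> gr i}"

definition pairing :: "('a::zero \<Rightarrow> complex) \<Rightarrow> ('i \<Rightarrow> 'a) \<Rightarrow> complex" where
  "pairing \<phi> x = (\<Sum>i | \<phi> (x i) \<noteq> 0. \<phi> (x i))"

definition completion_scale ::
    "(complex \<Rightarrow> 'a \<Rightarrow> 'a) \<Rightarrow> complex \<Rightarrow> ('i \<Rightarrow> 'a) \<Rightarrow> ('i \<Rightarrow> 'a)" where
  "completion_scale scl a x = (\<lambda>i. scl a (x i))"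

text \<open>Componentwise action on the completion.  It is meant for finite sums \<open>T\<close> of homogeneous
  operators, for which the sum over \<open>j\<close> is finite.\<close>

definition completion_op ::
    "('i \<Rightarrow> 'a::ab_group_add set) \<Rightarrow> ('a \<Rightarrow> 'a) \<Rightarrow> ('i \<Rightarrow> 'a) \<Rightarrow> ('i \<Rightarrow> 'a)" where
  "completion_op gr T x =
     (\<lambda>i. \<Sum>j | hom_comp gr (T (x j)) i \<noteq> 0. hom_comp gr (T (x j)) i)"


section \<open>Rational functions of several variables\<close>

text \<open>A point of \<open>\<complex>\<^sup>n\<close> is a list of length \<open>n\<close>, so the variable \<open>z\<^sub>i\<close> is \<open>zs ! (i - 1)\<close>.\<close>

definition config :: "nat \<Rightarrow> complex list set" where
  "config n = {zs. length zs = n \<and> distinct zs}"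

definition config_nonzero :: "nat \<Rightarrow> complex list set" where
  "config_nonzero n = {zs \<in> config n. 0 \<notin> set zs}"

definition polynomial_fun :: "nat \<Rightarrow> (complex list \<Rightarrow> complex) \<Rightarrow> bool" where
  "polynomial_fun n p \<longleftrightarrow>
     (\<exists>M c. finite (M :: nat list set) \<and>
        (\<forall>zs. length zs = n \<longrightarrow> p zs = (\<Sum>e\<in>M. c e * (\<Prod>i<n. zs ! i ^ (e ! i)))))"

definition difference_product :: "nat \<Rightarrow> (nat \<Rightarrow> nat \<Rightarrow> int) \<Rightarrow> complex list \<Rightarrow> complex" where
  "difference_product n b zs = (\<Prod>j<n. \<Prod>i<j. (zs ! i - zs ! j) powi b i j)"

text \<open>Rational functions are compared only off their possible poles, so the values of \<open>R\<close> outside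
  \<open>config_nonzero n\<close> are irrelevant.  The exponents \<open>a i\<close> and \<open>b i j\<close> bound the pole orders along
  \<open>z\<^sub>i = 0\<close> and \<open>z\<^sub>i = z\<^sub>j\<close>.\<close>

definition rational_with_exponents ::
    "nat \<Rightarrow> (nat \<Rightarrow> nat) \<Rightarrow> (nat \<Rightarrow> nat \<Rightarrow> nat) \<Rightarrow> (complex list \<Rightarrow> complex) \<Rightarrow> bool" where
  "rational_with_exponents n a b R \<longleftrightarrow>
     (\<exists>p. polynomial_fun n p \<and>
       (\<forall>zs\<in>config_nonzero n.
          R zs = p zs / ((\<Prod>i<n. zs ! i ^ a i) * difference_product n (\<lambda>i j. int (b i j)) zs)))"

definition rational_poles :: "nat \<Rightarrow> (complex list \<Rightarrow> complex) \<Rightarrow> bool" where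
  "rational_poles n R \<longleftrightarrow> (\<exists>a b. rational_with_exponents n a b R)"

definition pole_order_zero :: "nat \<Rightarrow> nat \<Rightarrow> (complex list \<Rightarrow> complex) \<Rightarrow> nat" where
  "pole_order_zero n i R = (LEAST m. \<exists>a b. a i = m \<and> rational_with_exponents n a b R)"


section \<open>Series of products and iterates of vertex operators\<close>

text \<open>A vertex operator map \<open>Y(u,x)v = \<Sum>\<^sub>k Y\<^sub>k(u)v x\<^sup>-\<^sup>k\<^sup>-\<^sup>1\<close> is given by its modes,
  \<open>Y u k v\<close> standing for \<open>Y\<^sub>k(u)v\<close>.\<close>

definition mode_product :: "('u \<Rightarrow> int \<Rightarrow> 'a \<Rightarrow> 'a) \<Rightarrow> 'u list \<Rightarrow> int list \<Rightarrow> 'a \<Rightarrow> 'a" where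
  "mode_product Y us ks v = foldr (\<lambda>(u, k). Y u k) (zip us ks) v"

definition abs_has_sum :: "('k \<Rightarrow> complex) \<Rightarrow> 'k set \<Rightarrow> complex \<Rightarrow> bool" where
  "abs_has_sum t K s \<longleftrightarrow> (\<lambda>k. norm (t k)) summable_on K \<and> (t has_sum s) K"

definition radially_ordered :: "complex list \<Rightarrow> bool" where
  "radially_ordered zs \<longleftrightarrow> sorted_wrt (\<lambda>x y. norm x > norm y) zs \<and> 0 \<notin> set zs"

definition product_term :: "(int list \<Rightarrow> complex) \<Rightarrow> complex list \<Rightarrow> int list \<Rightarrow> complex" where
  "product_term c zs ks = c ks * (\<Prod>i<length zs. zs ! i powi (- (ks ! i) - 1))"

definition product_converges_to ::
    "nat \<Rightarrow> (int list \<Rightarrow> complex) \<Rightarrow> (complex list \<Rightarrow> complex) \<Rightarrow> bool" where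
  "product_converges_to n c R \<longleftrightarrow>
     (\<forall>zs. length zs = n \<and> radially_ordered zs \<longrightarrow>
        abs_has_sum (product_term c zs) {ks. length ks = n} (R zs))"

definition iterate_term ::
    "(int \<Rightarrow> int \<Rightarrow> complex) \<Rightarrow> complex \<Rightarrow> complex \<Rightarrow> int \<times> int \<Rightarrow> complex" where
  "iterate_term c z1 z2 = (\<lambda>(k1, k2). c k1 k2 * (z1 - z2) powi (- k1 - 1) * z2 powi (- k2 - 1))"

definition iterate_converges_to ::
    "(int \<Rightarrow> int \<Rightarrow> complex) \<Rightarrow> (complex list \<Rightarrow> complex) \<Rightarrow> bool" where
  "iterate_converges_to c R \<longleftrightarrow>
     (\<forall>z1 z2. norm z2 > norm (z1 - z2) \<and> norm (z1 - z2) > 0 \<longrightarrow>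
        abs_has_sum (iterate_term c z1 z2) UNIV (R [z1, z2]))"

definition product_iterate_agree ::
    "(int list \<Rightarrow> complex) \<Rightarrow> (int \<Rightarrow> int \<Rightarrow> complex) \<Rightarrow> bool" where
  "product_iterate_agree c d \<longleftrightarrow>
     (\<forall>z1 z2. norm z1 > norm z2 \<and> norm z2 > norm (z1 - z2) \<and> norm (z1 - z2) > 0 \<longrightarrow>
        (\<Sum>\<^sub>\<infinity>ks\<in>{ks. length ks = 2}. product_term c [z1, z2] ks) =
        (\<Sum>\<^sub>\<infinity>k\<in>UNIV. iterate_term d z1 z2 k))"

definition product_rational :: "nat \<Rightarrow> (int list \<Rightarrow> complex) \<Rightarrow> bool" where
  "product_rational n c \<longleftrightarrow> (\<exists>R. rational_poles n R \<and> product_converges_to n c R)"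

definition iterate_rational :: "(int \<Rightarrow> int \<Rightarrow> complex) \<Rightarrow> bool" where
  "iterate_rational d \<longleftrightarrow> (\<exists>R. rational_poles 2 R \<and> iterate_converges_to d R)"

text \<open>The variant without a restriction on the position of the poles.\<close>

definition product_rational_any_poles :: "nat \<Rightarrow> (int list \<Rightarrow> complex) \<Rightarrow> bool" where
  "product_rational_any_poles n c \<longleftrightarrow>
     (\<exists>p q. polynomial_fun n p \<and> polynomial_fun n q \<and>
        (\<forall>zs. length zs = n \<and> radially_ordered zs \<longrightarrow> q zs \<noteq> 0) \<and>
        product_converges_to n c (\<lambda>zs. p zs / q zs))"

definition product_pole_order_less :: "(int list \<Rightarrow> complex) \<Rightarrow> nat \<Rightarrow> bool" where
  "product_pole_order_less c C \<longleftrightarrow>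
     (\<exists>R. rational_poles 2 R \<and> product_converges_to 2 c R \<and> pole_order_zero 2 0 R < C)"


section \<open>Meromorphic open-string vertex algebras\<close>

text \<open>\<open>D v = lim\<^sub>x\<^sub>\<rightarrow>\<^sub>0 d/dx Y(v,x)\<one>\<close> is the coefficient of \<open>x\<close> in \<open>Y(v,x)\<one>\<close>.\<close>

definition D_op :: "('v \<Rightarrow> int \<Rightarrow> 'v \<Rightarrow> 'v) \<Rightarrow> 'v \<Rightarrow> 'v \<Rightarrow> 'v" where
  "D_op Y vac v = Y v (- 2) vac"

text \<open>All identities between formal series are stated for the coefficient of \<open>x\<^sup>-\<^sup>k\<^sup>-\<^sup>1\<close>; that of
  \<open>x d/dx Y(u,x)\<close> is \<open>(-k-1) Y\<^sub>k(u)\<close> and that of \<open>d/dx Y(u,x)\<close> is \<open>-k Y\<^sub>k\<^sub>-\<^sub>1(u)\<close>.\<close>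

locale mosva = V: graded_vector_space scaleV grV
  for scaleV :: "complex \<Rightarrow> 'v::ab_group_add \<Rightarrow> 'v" and grV :: "int \<Rightarrow> 'v set" +
  fixes YV :: "'v \<Rightarrow> int \<Rightarrow> 'v \<Rightarrow> 'v"
    and vac :: 'v
  assumes grV_lower_bound: "\<exists>N. \<forall>n<N. grV n = {0}"
    and YV_linear_right: "Vector_Spaces.linear scaleV scaleV (\<lambda>v. YV u k v)"
    and YV_linear_left: "Vector_Spaces.linear scaleV scaleV (\<lambda>u. YV u k v)"
    and YV_d_bracket:
      "grading_op scaleV of_int grV (YV u k v) - YV u k (grading_op scaleV of_int grV v) =
         scaleV (of_int (- k - 1)) (YV u k v) + YV (grading_op scaleV of_int grV u) k v"
    and YV_vacuum: "YV vac k v = (if k = - 1 then v else 0)"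
    and YV_creation: "k \<ge> 0 \<Longrightarrow> YV u k vac = 0" "YV u (- 1) vac = u"
    and YV_D_derivative: "scaleV (of_int (- k)) (YV u (k - 1) v) = YV (D_op YV vac u) k v"
    and YV_D_bracket:
      "scaleV (of_int (- k)) (YV u (k - 1) v) =
         D_op YV vac (YV u k v) - YV u k (D_op YV vac v)"
    and YV_product_rational:
      "\<phi> \<in> graded_dual scaleV grV \<Longrightarrow>
         product_rational (length us) (\<lambda>ks. \<phi> (mode_product YV us ks v))"
    and YV_iterate_rational:
      "\<phi> \<in> graded_dual scaleV grV \<Longrightarrow>
         iterate_rational (\<lambda>k1 k2. \<phi> (YV (YV u1 k1 u2) k2 v))"
    and YV_associativity:
      "\<phi> \<in> graded_dual scaleV grV \<Longrightarrow>
         product_iterate_agree (\<lambda>ks. \<phi> (mode_product YV [u1, u2] ks v))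
                               (\<lambda>k1 k2. \<phi> (YV (YV u1 k1 u2) k2 v))"


section \<open>Bimodules\<close>

locale mosva_bimodule = mosva scaleV grV YV vac + W: graded_vector_space scaleW grW
  for scaleV :: "complex \<Rightarrow> 'v::ab_group_add \<Rightarrow> 'v" and grV :: "int \<Rightarrow> 'v set"
    and YV :: "'v \<Rightarrow> int \<Rightarrow> 'v \<Rightarrow> 'v" and vac :: 'v
    and scaleW :: "complex \<Rightarrow> 'w::ab_group_add \<Rightarrow> 'w" and grW :: "complex \<Rightarrow> 'w set" +
  fixes DW :: "'w \<Rightarrow> 'w"
    and YL :: "'v \<Rightarrow> int \<Rightarrow> 'w \<Rightarrow> 'w"
    and YR :: "'w \<Rightarrow> int \<Rightarrow> 'v \<Rightarrow> 'w"
  assumes grW_lower_bound: "\<exists>r. \<forall>m. Re m < r \<longrightarrow> grW m = {0}"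
    and DW_linear: "Vector_Spaces.linear scaleW scaleW DW"
    and DW_weight: "w \<in> grW m \<Longrightarrow> DW w \<in> grW (m + 1)"
    and YL_linear_right: "Vector_Spaces.linear scaleW scaleW (\<lambda>w. YL u k w)"
    and YL_linear_left: "Vector_Spaces.linear scaleV scaleW (\<lambda>u. YL u k w)"
    and YR_linear_right: "Vector_Spaces.linear scaleV scaleW (\<lambda>v. YR w k v)"
    and YR_linear_left: "Vector_Spaces.linear scaleW scaleW (\<lambda>w. YR w k v)"
  \<comment> \<open>left module\<close>
    and YL_d_bracket:
      "grading_op scaleW (\<lambda>m. m) grW (YL u k w) - YL u k (grading_op scaleW (\<lambda>m. m) grW w) =
         YL (grading_op scaleV of_int grV u) k w + scaleW (of_int (- k - 1)) (YL u k w)"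
    and YL_vacuum: "YL vac k w = (if k = - 1 then w else 0)"
    and YL_D_derivative: "scaleW (of_int (- k)) (YL u (k - 1) w) = YL (D_op YV vac u) k w"
    and YL_D_bracket: "scaleW (of_int (- k)) (YL u (k - 1) w) = DW (YL u k w) - YL u k (DW w)"
    and YL_product_rational:
      "\<phi> \<in> graded_dual scaleW grW \<Longrightarrow>
         product_rational (length us) (\<lambda>ks. \<phi> (mode_product YL us ks w))"
    and YL_iterate_rational:
      "\<phi> \<in> graded_dual scaleW grW \<Longrightarrow>
         iterate_rational (\<lambda>k1 k2. \<phi> (YL (YV u1 k1 u2) k2 w))"
    and YL_associativity:
      "\<phi> \<in> graded_dual scaleW grW \<Longrightarrow>
         product_iterate_agree (\<lambda>ks. \<phi> (mode_product YL [u1, u2] ks w))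
                               (\<lambda>k1 k2. \<phi> (YL (YV u1 k1 u2) k2 w))"
  \<comment> \<open>right module\<close>
    and YR_d_bracket:
      "grading_op scaleW (\<lambda>m. m) grW (YR w k v) - YR w k (grading_op scaleV of_int grV v) =
         YR (grading_op scaleW (\<lambda>m. m) grW w) k v + scaleW (of_int (- k - 1)) (YR w k v)"
    and YR_creation: "k \<ge> 0 \<Longrightarrow> YR w k vac = 0" "YR w (- 1) vac = w"
    and YR_D_derivative: "scaleW (of_int (- k)) (YR w (k - 1) v) = YR (DW w) k v"
    and YR_D_bracket:
      "scaleW (of_int (- k)) (YR w (k - 1) v) = DW (YR w k v) - YR w k (D_op YV vac v)"
    and YR_product_rational:
      "\<phi> \<in> graded_dual scaleW grW \<Longrightarrow>
         product_rational (Suc (length us))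
           (\<lambda>ks. \<phi> (YR w (hd ks) (mode_product YV us (tl ks) v)))"
    and YR_iterate_rational:
      "\<phi> \<in> graded_dual scaleW grW \<Longrightarrow>
         iterate_rational (\<lambda>k1 k2. \<phi> (YR (YR w k1 u1) k2 u2))"
    and YR_associativity:
      "\<phi> \<in> graded_dual scaleW grW \<Longrightarrow>
         product_iterate_agree (\<lambda>ks. \<phi> (YR w (ks ! 0) (YV u1 (ks ! 1) u2)))
                               (\<lambda>k1 k2. \<phi> (YR (YR w k1 u1) k2 u2))"
  \<comment> \<open>compatibility\<close>
    and YL_YR_product_rational:
      "\<phi> \<in> graded_dual scaleW grW \<Longrightarrow>
         product_rational_any_poles (length us + Suc (length vs))
           (\<lambda>ks. \<phi> (mode_product YL us (take (length us) ks)
                     (YR w (ks ! length us)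
                       (mode_product YV vs (drop (Suc (length us)) ks) v))))"
    and YL_YR_compatibility:
      "\<phi> \<in> graded_dual scaleW grW \<Longrightarrow>
         \<exists>R. rational_poles 2 R \<and>
             product_converges_to 2 (\<lambda>ks. \<phi> (YL u (ks ! 0) (YR w (ks ! 1) v))) R \<and>
             iterate_converges_to (\<lambda>k1 k2. \<phi> (YR (YL u k1 w) k2 v)) R"


section \<open>Pole-order conditions\<close>

definition pole_order_condition_algebra ::
    "(complex \<Rightarrow> 'v::ab_group_add \<Rightarrow> 'v) \<Rightarrow> (int \<Rightarrow> 'v set) \<Rightarrow> ('v \<Rightarrow> int \<Rightarrow> 'v \<Rightarrow> 'v) \<Rightarrow> bool" where
  "pole_order_condition_algebra scaleV grV YV \<longleftrightarrow>
     (\<forall>u1 v. \<exists>C. \<forall>\<phi>\<in>graded_dual scaleV grV. \<forall>u2.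
        product_pole_order_less (\<lambda>ks. \<phi> (YV u1 (ks ! 0) (YV u2 (ks ! 1) v))) C)"

definition pole_order_condition_bimodule ::
    "('v \<Rightarrow> int \<Rightarrow> 'v \<Rightarrow> 'v) \<Rightarrow> (complex \<Rightarrow> 'w::ab_group_add \<Rightarrow> 'w) \<Rightarrow> (complex \<Rightarrow> 'w set) \<Rightarrow>
     ('v \<Rightarrow> int \<Rightarrow> 'w \<Rightarrow> 'w) \<Rightarrow> ('w \<Rightarrow> int \<Rightarrow> 'v \<Rightarrow> 'w) \<Rightarrow> bool" where
  "pole_order_condition_bimodule YV scaleW grW YL YR \<longleftrightarrow>
     (\<forall>u1 w. \<exists>C. \<forall>\<phi>\<in>graded_dual scaleW grW. \<forall>u2.
        product_pole_order_less (\<lambda>ks. \<phi> (YL u1 (ks ! 0) (YL u2 (ks ! 1) w))) C) \<and>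
     (\<forall>w u2. \<exists>C. \<forall>\<phi>\<in>graded_dual scaleW grW. \<forall>u1.
        product_pole_order_less (\<lambda>ks. \<phi> (YR w (ks ! 0) (YV u1 (ks ! 1) u2))) C) \<and>
     (\<forall>u1 u2. \<exists>C. \<forall>\<phi>\<in>graded_dual scaleW grW. \<forall>w.
        product_pole_order_less (\<lambda>ks. \<phi> (YL u1 (ks ! 0) (YR w (ks ! 1) u2))) C)"


section \<open>Completion-valued rational functions\<close>

text \<open>The space of rational functions in \<open>n\<close> variables with values in the completion.  Its elements
  are extensional (\<open>undefined\<close> off \<open>config n\<close>), so that \<open>=\<close> is equality of maps on \<open>config n\<close>.
  A power series \<open>g\<close> over the graded space is given by its coefficients \<open>g ks\<close>, where
  \<open>length ks = n\<close>.\<close>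

definition rational_maps ::
    "(complex \<Rightarrow> 'w::ab_group_add \<Rightarrow> 'w) \<Rightarrow> ('i \<Rightarrow> 'w set) \<Rightarrow> nat \<Rightarrow>
     (complex list \<Rightarrow> 'i \<Rightarrow> 'w) set" where
  "rational_maps scl gr n =
     {f \<in> config n \<rightarrow>\<^sub>E completion gr.
       (\<forall>\<phi>\<in>graded_dual scl gr. \<exists>p b. polynomial_fun n p \<and>
          (\<forall>zs\<in>config n.
             pairing \<phi> (f zs) = p zs / difference_product n (\<lambda>i j. int (b i j)) zs)) \<and>
       (\<exists>(b :: nat \<Rightarrow> nat \<Rightarrow> int) (g :: nat list \<Rightarrow> 'w). \<forall>\<phi>\<in>graded_dual scl gr.
          finite {ks. length ks = n \<and> \<phi> (g ks) \<noteq> 0} \<and>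
          (\<forall>zs\<in>config n.
             difference_product n b zs * pairing \<phi> (f zs) =
             (\<Sum>ks | length ks = n \<and> \<phi> (g ks) \<noteq> 0. \<phi> (g ks) * (\<Prod>i<n. zs ! i ^ (ks ! i)))))}"

definition completion_has_sum ::
    "(complex \<Rightarrow> 'w::ab_group_add \<Rightarrow> 'w) \<Rightarrow> ('i \<Rightarrow> 'w set) \<Rightarrow> ('k \<Rightarrow> 'i \<Rightarrow> 'w) \<Rightarrow>
     ('i \<Rightarrow> 'w) \<Rightarrow> bool" where
  "completion_has_sum scl gr t s \<longleftrightarrow>
     s \<in> completion gr \<and>
     (\<forall>\<phi>\<in>graded_dual scl gr. abs_has_sum (\<lambda>k. pairing \<phi> (t k)) UNIV (pairing \<phi> s))"

text \<open>For a series \<open>t zs\<close> depending on a point \<open>zs\<close>: it converges absolutely on the region \<open>S\<close>, and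
  its sum is there the restriction of the rational map \<open>g\<close>.\<close>

definition sum_extends_to ::
    "(complex \<Rightarrow> 'w::ab_group_add \<Rightarrow> 'w) \<Rightarrow> ('i \<Rightarrow> 'w set) \<Rightarrow> nat \<Rightarrow> complex list set \<Rightarrow>
     (complex list \<Rightarrow> 'k \<Rightarrow> 'i \<Rightarrow> 'w) \<Rightarrow> (complex list \<Rightarrow> 'i \<Rightarrow> 'w) \<Rightarrow> bool" where
  "sum_extends_to scl gr n S t g \<longleftrightarrow>
     g \<in> rational_maps scl gr n \<and> (\<forall>zs\<in>S. completion_has_sum scl gr (t zs) (g zs))"

definition rational_extension ::
    "(complex \<Rightarrow> 'w::ab_group_add \<Rightarrow> 'w) \<Rightarrow> ('i \<Rightarrow> 'w set) \<Rightarrow> nat \<Rightarrow> complex list set \<Rightarrow>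
     (complex list \<Rightarrow> 'k \<Rightarrow> 'i \<Rightarrow> 'w) \<Rightarrow> (complex list \<Rightarrow> 'i \<Rightarrow> 'w)" where
  "rational_extension scl gr n S t = (THE g. sum_extends_to scl gr n S t g)"

text \<open>The series \<open>Y\<^sup>L(u\<^sub>1,z\<^sub>1) Y\<^sup>L(u\<^sub>2,z\<^sub>2) f(z\<^sub>3,\<dots>)\<close> and \<open>Y\<^sup>L(Y\<^sub>V(u\<^sub>1,z\<^sub>1-z\<^sub>2)u\<^sub>2,z\<^sub>2) f(z\<^sub>3,\<dots>)\<close>.\<close>

definition YL_product_series ::
    "(complex \<Rightarrow> 'w::ab_group_add \<Rightarrow> 'w) \<Rightarrow> ('i \<Rightarrow> 'w set) \<Rightarrow> ('v \<Rightarrow> int \<Rightarrow> 'w \<Rightarrow> 'w) \<Rightarrow>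
     'v \<Rightarrow> 'v \<Rightarrow> (complex list \<Rightarrow> 'i \<Rightarrow> 'w) \<Rightarrow> complex list \<Rightarrow> int \<times> int \<Rightarrow> 'i \<Rightarrow> 'w" where
  "YL_product_series scl gr YL u1 u2 f zs =
     (\<lambda>(k1, k2). completion_scale scl (zs ! 0 powi (- k1 - 1) * zs ! 1 powi (- k2 - 1))
        (completion_op gr (YL u1 k1) (completion_op gr (YL u2 k2) (f (drop 2 zs)))))"

definition YL_iterate_series ::
    "(complex \<Rightarrow> 'w::ab_group_add \<Rightarrow> 'w) \<Rightarrow> ('i \<Rightarrow> 'w set) \<Rightarrow> ('v \<Rightarrow> int \<Rightarrow> 'v \<Rightarrow> 'v) \<Rightarrow>
     ('v \<Rightarrow> int \<Rightarrow> 'w \<Rightarrow> 'w) \<Rightarrow> 'v \<Rightarrow> 'v \<Rightarrow> (complex list \<Rightarrow> 'i \<Rightarrow> 'w) \<Rightarrow>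
     complex list \<Rightarrow> int \<times> int \<Rightarrow> 'i \<Rightarrow> 'w" where
  "YL_iterate_series scl gr YV YL u1 u2 f zs =
     (\<lambda>(k1, k2). completion_scale scl
        ((zs ! 0 - zs ! 1) powi (- k1 - 1) * zs ! 1 powi (- k2 - 1))
        (completion_op gr (YL (YV u1 k1 u2) k2) (f (drop 2 zs))))"

definition product_region :: "nat \<Rightarrow> complex list set" where
  "product_region n =
     {zs \<in> config (n + 2). norm (zs ! 0) > norm (zs ! 1) \<and>
        (\<forall>i\<in>{2..<n + 2}. norm (zs ! 1) > norm (zs ! i))}"

definition iterate_region :: "nat \<Rightarrow> complex list set" where
  "iterate_region n =
     {zs \<in> config (n + 2). norm (zs ! 0) > norm (zs ! 1) \<and>
        (\<forall>i\<in>{2..<n + 2}. norm (zs ! 1) > norm (zs ! 0 - zs ! 1) + norm (zs ! i))}"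

end

theory Submission
  imports Defs
begin

text \<open>Fix a functional and \<open>z\<^sub>3, \<dots>, z\<^sub>n\<^sub>+\<^sub>2\<close>, and put \<open>t = (z\<^sub>1 - z\<^sub>2) / z\<^sub>2\<close>,
  \<open>s = 1 / z\<^sub>2\<close>.  A rational function with poles only at \<open>z\<^sub>i = z\<^sub>j\<close> is built from monomials in
  \<open>t\<close>, \<open>s\<close> and geometric series in \<open>z\<^sub>i s\<close> and \<open>z\<^sub>i s - t\<close>, so it has an absolutely convergent
  Laurent expansion in \<open>(t, s)\<close> wherever \<open>|t| + |z\<^sub>i s| < 1\<close>, i.e. \<open>|z\<^sub>2| > |z\<^sub>1 - z\<^sub>2| + |z\<^sub>i|\<close>.
  It remains to identify its coefficients with those of the iterate series.  The coefficient of \<open>s\<^sup>N\<close>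
  involves only finitely many homogeneous components of \<open>f\<close>, hence a vector of \<open>W\<close> itself, for
  which associativity in the module, split by total degree, turns the product into the iterate;
  then the powers of \<open>t\<close> are compared.  The extensions agree because a rational function is
  determined by its values on \<open>iterate_region\<close>.\<close>

lemmas linear_imp_module_hom = module_hom_iff_linear[THEN iffD2]

section \<open>Graded spaces and the pairing with the completion\<close>

definition dual_support :: "('i \<Rightarrow> 'a set) \<Rightarrow> ('a \<Rightarrow> complex) \<Rightarrow> 'i set" where
  "dual_support gr \<phi> = {i. \<exists>w\<in>gr i. \<phi> w \<noteq> 0}"

context graded_vector_space
begin

lemma decomposition_hom_comp: "homogeneous_decomposition gr w (hom_comp gr w)"
  unfolding hom_comp_def by (rule theI'[OF unique_decomposition])

lemma hom_comp_in [simp]: "hom_comp gr w i \<in> gr i"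
  and finite_hom_comp_support: "finite {i. hom_comp gr w i \<noteq> 0}"
  and sum_hom_comp: "(\<Sum>i | hom_comp gr w i \<noteq> 0. hom_comp gr w i) = w"
  using decomposition_hom_comp[of w] by (auto simp: homogeneous_decomposition_def)

lemma hom_comp_in_completion: "hom_comp gr w \<in> completion gr"
  by (simp add: completion_def)

lemma zero_in_gr [simp]: "0 \<in> gr i"
  using subspace_gr by (rule subspace_0)

text \<open>A finite \<open>J\<close> larger than the support is allowed so that several vectors can
  be decomposed over one index set, as is needed for sums.\<close>

lemma hom_comp_eqI:
  assumes c: "\<And>i. c i \<in> gr i" and J: "finite J" "\<And>i. i \<notin> J \<Longrightarrow> c i = 0"
    and w: "w = sum c J"
  shows "hom_comp gr w = c"
proof -
  have sub: "{i. c i \<noteq> 0} \<subseteq> J" using J by auto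
  have "sum c J = (\<Sum>i | c i \<noteq> 0. c i)"
    by (rule sum.mono_neutral_right) (use J sub in auto)
  then have "homogeneous_decomposition gr w c"
    using c w J finite_subset[OF sub] by (auto simp: homogeneous_decomposition_def)
  then show ?thesis using unique_decomposition decomposition_hom_comp by blast
qed

lemma hom_comp_homogeneous:
  assumes "w \<in> gr j" shows "hom_comp gr w i = (if i = j then w else 0)"
proof -
  have "hom_comp gr w = (\<lambda>i. if i = j then w else 0)"
    by (rule hom_comp_eqI[where J = "{j}"]) (use assms in auto)
  then show ?thesis by simp
qed

lemma hom_comp_add: "hom_comp gr (v + w) i = hom_comp gr v i + hom_comp gr w i"
proof -
  let ?J = "{i. hom_comp gr v i \<noteq> 0} \<union> {i. hom_comp gr w i \<noteq> 0}"
  have 1: "sum (hom_comp gr u) ?J = u" if "u \<in> {v, w}" for u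
  proof -
    have "sum (hom_comp gr u) ?J = (\<Sum>i | hom_comp gr u i \<noteq> 0. hom_comp gr u i)"
      by (rule sum.mono_neutral_right) (use that finite_hom_comp_support in auto)
    then show ?thesis by (simp add: sum_hom_comp)
  qed
  have "hom_comp gr (v + w) = (\<lambda>i. hom_comp gr v i + hom_comp gr w i)"
    by (rule hom_comp_eqI[where J = ?J])
      (auto simp: subspace_gr subspace_add finite_hom_comp_support sum.distrib 1)
  then show ?thesis by simp
qed

lemma hom_comp_scale: "hom_comp gr (scl a w) i = scl a (hom_comp gr w i)"
proof -
  have "hom_comp gr (scl a w) = (\<lambda>i. scl a (hom_comp gr w i))"
    by (rule hom_comp_eqI[where J = "{i. hom_comp gr w i \<noteq> 0}"])
      (auto simp: subspace_gr subspace_scale finite_hom_comp_support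
        sum_hom_comp scale_sum_right[symmetric])
  then show ?thesis by simp
qed

lemma linear_hom_comp: "Vector_Spaces.linear scl scl (\<lambda>w. hom_comp gr w i)"
  by unfold_locales (simp_all add: hom_comp_add hom_comp_scale)

lemma hom_comp_0 [simp]: "hom_comp gr 0 i = 0"
  using hom_comp_homogeneous[OF zero_in_gr] by simp

lemma hom_comp_sum: "hom_comp gr (sum g A) i = (\<Sum>a\<in>A. hom_comp gr (g a) i)"
  by (induction A rule: infinite_finite_induct) (auto simp: hom_comp_add)

lemma grading_op_homogeneous:
  assumes "w \<in> gr j" shows "grading_op scl wt gr w = scl (wt j) w"
proof (cases "w = 0")
  case False
  have "{i. hom_comp gr w i \<noteq> 0} = {j}"
    using False by (auto simp: hom_comp_homogeneous[OF assms])
  then show ?thesis by (simp add: grading_op_def hom_comp_homogeneous[OF assms])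
qed (simp add: grading_op_def)

text \<open>The grading operator multiplies the component of degree \<open>i\<close> by
  \<open>wt i\<close>, so comparing components forces the weight. This turns the bracket axioms for
  the grading operators into statements about degrees of modes.\<close>

lemma grading_op_eigenvector:
  assumes "grading_op scl wt gr w = scl \<mu> w" and nz: "hom_comp gr w i \<noteq> 0"
  shows "wt i = \<mu>"
proof -
  have "hom_comp gr (grading_op scl wt gr w) = (\<lambda>i. scl (wt i) (hom_comp gr w i))"
    by (rule hom_comp_eqI[where J = "{i. hom_comp gr w i \<noteq> 0}"])
      (auto simp: subspace_gr subspace_scale finite_hom_comp_support grading_op_def)
  then have "scl (wt i) (hom_comp gr w i) = scl \<mu> (hom_comp gr w i)"
    using assms(1) by (metis hom_comp_scale)
  with nz show ?thesis by simp
qed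

text \<open>A linear functional with value 1 at \<open>w\<close> exists by extension of
  \<open>{w}\<close> to a basis; composing it with the projection to degree \<open>i\<close> puts it
  into the graded dual.\<close>

lemma graded_dual_separates:
  assumes "w \<in> gr i" "w \<noteq> 0"
  obtains \<phi> where "\<phi> \<in> graded_dual scl gr" "\<phi> w \<noteq> 0" "\<And>j v. j \<noteq> i \<Longrightarrow> v \<in> gr j \<Longrightarrow> \<phi> v = 0"
proof -
  interpret C: vector_space "(*) :: complex \<Rightarrow> complex \<Rightarrow> complex"
    by unfold_locales (auto simp: algebra_simps)
  interpret P: vector_space_pair scl "(*) :: complex \<Rightarrow> complex \<Rightarrow> complex" ..
  have ind: "independent {w}" using assms by simp
  define \<psi> where "\<psi> = P.construct {w} (\<lambda>_. 1)"
  have lin: "Vector_Spaces.linear scl (*) \<psi>"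
    unfolding \<psi>_def by (rule P.linear_construct[OF ind])
  have 1: "\<psi> w = 1" unfolding \<psi>_def by (rule P.construct_basis[OF ind]) simp
  define \<phi> where "\<phi> = (\<lambda>v. \<psi> (hom_comp gr v i))"
  have lin': "Vector_Spaces.linear scl (*) \<phi>"
    using Vector_Spaces.linear_compose[OF linear_hom_comp lin] by (simp add: \<phi>_def o_def)
  have 0: "\<phi> v = 0" if "j \<noteq> i" "v \<in> gr j" for j v
    using that(1) module_hom.zero[OF linear_imp_module_hom[OF lin]] by (simp add: \<phi>_def hom_comp_homogeneous[OF that(2)])
  have "{j. \<exists>v\<in>gr j. \<phi> v \<noteq> 0} \<subseteq> {i}" using 0 by auto
  then have "\<phi> \<in> graded_dual scl gr"
    using lin' finite_subset by (auto simp: graded_dual_def)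
  moreover have "\<phi> w \<noteq> 0" using 1 assms by (simp add: \<phi>_def hom_comp_homogeneous)
  ultimately show ?thesis using 0 that by blast
qed

lemma graded_dualD:
  assumes "\<phi> \<in> graded_dual scl gr"
  shows graded_dual_linear: "Vector_Spaces.linear scl (*) \<phi>"
    and finite_dual_support: "finite (dual_support gr \<phi>)"
  using assms by (auto simp: graded_dual_def dual_support_def)

lemma pairing_eq_sum:
  assumes "x \<in> completion gr" "finite J" "dual_support gr \<phi> \<subseteq> J"
  shows "pairing \<phi> x = (\<Sum>j\<in>J. \<phi> (x j))"
  unfolding pairing_def
  by (rule sum.mono_neutral_left) (use assms in \<open>auto simp: completion_def dual_support_def\<close>)

lemma pairing_hom_comp:
  assumes "\<phi> \<in> graded_dual scl gr" shows "pairing \<phi> (hom_comp gr w) = \<phi> w"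
proof -
  let ?J = "dual_support gr \<phi> \<union> {i. hom_comp gr w i \<noteq> 0}"
  have fin: "finite ?J" using finite_dual_support[OF assms] finite_hom_comp_support by auto
  have "(\<Sum>i\<in>?J. hom_comp gr w i) = (\<Sum>i | hom_comp gr w i \<noteq> 0. hom_comp gr w i)"
    by (rule sum.mono_neutral_right) (use fin in auto)
  then have "\<phi> w = \<phi> (\<Sum>i\<in>?J. hom_comp gr w i)" by (simp add: sum_hom_comp)
  also have "\<dots> = (\<Sum>i\<in>?J. \<phi> (hom_comp gr w i))"
    by (rule module_hom.sum[OF linear_imp_module_hom[OF graded_dual_linear[OF assms]]])
  finally show ?thesis
    using pairing_eq_sum[OF hom_comp_in_completion fin, of \<phi> w] by simp
qed

lemma pairing_scale:
  assumes "\<phi> \<in> graded_dual scl gr"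
  shows "pairing \<phi> (completion_scale scl a x) = a * pairing \<phi> x"
proof (cases "a = 0")
  case True
  then show ?thesis using module_hom.zero[OF linear_imp_module_hom[OF graded_dual_linear[OF assms]]]
    by (simp add: pairing_def completion_scale_def)
next
  case False
  then show ?thesis
    by (simp add: pairing_def completion_scale_def module_hom.scale[OF linear_imp_module_hom[OF graded_dual_linear[OF assms]]]
        sum_distrib_left)
qed

text \<open>It is enough to separate one component in which the elements differ, by a functional
  that sees only that degree.\<close>

lemma completion_eqI:
  assumes x: "x \<in> completion gr" and y: "y \<in> completion gr"
    and eq: "\<And>\<phi>. \<phi> \<in> graded_dual scl gr \<Longrightarrow> pairing \<phi> x = pairing \<phi> y"
  shows "x = y"
proof (rule ccontr)
  assume "x \<noteq> y"
  then obtain i where i: "x i \<noteq> y i" by auto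
  have "x i - y i \<in> gr i" using x y subspace_gr by (auto simp: completion_def subspace_diff)
  then obtain \<phi> where \<phi>: "\<phi> \<in> graded_dual scl gr" "\<phi> (x i - y i) \<noteq> 0"
    "\<And>j v. j \<noteq> i \<Longrightarrow> v \<in> gr j \<Longrightarrow> \<phi> v = 0"
    using graded_dual_separates[of "x i - y i" i] i by auto
  have sub: "dual_support gr \<phi> \<subseteq> {i}" using \<phi>(3) by (auto simp: dual_support_def)
  show False
    using eq[OF \<phi>(1)] \<phi>(2) module_hom.diff[OF linear_imp_module_hom[OF graded_dual_linear[OF \<phi>(1)]], of "x i" "y i"]
      pairing_eq_sum[OF x _ sub] pairing_eq_sum[OF y _ sub] by simp
qed

text \<open>\<open>r i\<close> contains the degrees from which \<open>T\<close> reaches degree \<open>i\<close>.\<close>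

definition degree_finite_op :: "('a \<Rightarrow> 'a) \<Rightarrow> ('i \<Rightarrow> 'i set) \<Rightarrow> bool" where
  "degree_finite_op T r \<longleftrightarrow> Vector_Spaces.linear scl scl T \<and> (\<forall>i. finite (r i)) \<and>
     (\<forall>i j. \<forall>w\<in>gr j. hom_comp gr (T w) i \<noteq> 0 \<longrightarrow> j \<in> r i)"

text \<open>The transpose of \<open>T\<close> preserves the graded dual: if
  \<open>\<phi> (T w)\<close> is nonzero, then \<open>T w\<close> has a component in one of the
  finitely many degrees that \<open>\<phi>\<close> sees, and each of these is reached from finitely
  many degrees only.\<close>

lemma dual_comp_op:
  assumes \<phi>: "\<phi> \<in> graded_dual scl gr" and T: "degree_finite_op T r"
  shows "\<phi> \<circ> T \<in> graded_dual scl gr"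
    and "dual_support gr (\<phi> \<circ> T) \<subseteq> (\<Union>i\<in>dual_support gr \<phi>. r i)"
proof -
  have lin: "Vector_Spaces.linear scl scl T" using T by (simp add: degree_finite_op_def)
  show sub: "dual_support gr (\<phi> \<circ> T) \<subseteq> (\<Union>i\<in>dual_support gr \<phi>. r i)"
  proof
    fix j assume "j \<in> dual_support gr (\<phi> \<circ> T)"
    then obtain w where w: "w \<in> gr j" "\<phi> (T w) \<noteq> 0" by (auto simp: dual_support_def)
    have "\<phi> (T w) = (\<Sum>i | hom_comp gr (T w) i \<noteq> 0. \<phi> (hom_comp gr (T w) i))"
      using module_hom.sum[OF linear_imp_module_hom[OF graded_dual_linear[OF \<phi>]]] by (metis sum_hom_comp)
    with w(2) obtain i where i: "hom_comp gr (T w) i \<noteq> 0" "\<phi> (hom_comp gr (T w) i) \<noteq> 0"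
      by (auto elim: sum.not_neutral_contains_not_neutral)
    have "i \<in> dual_support gr \<phi>" using i(2) hom_comp_in by (auto simp: dual_support_def)
    moreover have "j \<in> r i" using T w i by (auto simp: degree_finite_op_def)
    ultimately show "j \<in> (\<Union>i\<in>dual_support gr \<phi>. r i)" by auto
  qed
  have "finite (\<Union>i\<in>dual_support gr \<phi>. r i)"
    using T finite_dual_support[OF \<phi>] by (auto simp: degree_finite_op_def)
  with sub have "finite (dual_support gr (\<phi> \<circ> T))" using finite_subset by blast
  then show "\<phi> \<circ> T \<in> graded_dual scl gr"
    unfolding graded_dual_def dual_support_def
    using Vector_Spaces.linear_compose[OF lin graded_dual_linear[OF \<phi>]] by blast
qed

lemma completion_op_in_completion: "completion_op gr T x \<in> completion gr"
  by (auto simp: completion_def completion_op_def intro!: subspace_sum[OF subspace_gr])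

text \<open>Modes acting on the completion can thus be moved onto the functional. Only the degrees
  in the support of \<open>\<phi>\<close> count, each fed by finitely many source degrees, so the
  interchange of sums is finite.\<close>

lemma pairing_completion_op:
  assumes \<phi>: "\<phi> \<in> graded_dual scl gr" and T: "degree_finite_op T r"
    and x: "x \<in> completion gr"
  shows "pairing \<phi> (completion_op gr T x) = pairing (\<phi> \<circ> T) x"
proof -
  let ?I = "dual_support gr \<phi>"
  define J where "J = (\<Union>i\<in>?I. r i)"
  have finI: "finite ?I" using finite_dual_support[OF \<phi>] .
  have finJ: "finite J" using T finI by (auto simp: degree_finite_op_def J_def)
  have co: "completion_op gr T x i = (\<Sum>j\<in>J. hom_comp gr (T (x j)) i)" if "i \<in> ?I" for i
    unfolding completion_op_def
  proof (rule sum.mono_neutral_left[OF finJ])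
    show "{j. hom_comp gr (T (x j)) i \<noteq> 0} \<subseteq> J"
      using that T x by (fastforce simp: degree_finite_op_def J_def completion_def)
  qed auto
  have "pairing \<phi> (completion_op gr T x) = (\<Sum>i\<in>?I. \<phi> (completion_op gr T x i))"
    by (rule pairing_eq_sum[OF completion_op_in_completion finI]) simp
  also have "\<dots> = (\<Sum>i\<in>?I. \<Sum>j\<in>J. \<phi> (hom_comp gr (T (x j)) i))"
    by (intro sum.cong refl) (simp add: co module_hom.sum[OF linear_imp_module_hom[OF graded_dual_linear[OF \<phi>]]])
  also have "\<dots> = (\<Sum>j\<in>J. \<Sum>i\<in>?I. \<phi> (hom_comp gr (T (x j)) i))" by (rule sum.swap)
  also have "\<dots> = (\<Sum>j\<in>J. (\<phi> \<circ> T) (x j))"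
    by (simp add: pairing_hom_comp[OF \<phi>]
        flip: pairing_eq_sum[OF hom_comp_in_completion finI order_refl])
  also have "\<dots> = pairing (\<phi> \<circ> T) x"
    by (rule pairing_eq_sum[OF x finJ dual_comp_op(2)[OF \<phi> T, folded J_def], symmetric])
  finally show ?thesis .
qed

end

section \<open>Absolutely convergent families\<close>

lemma abs_has_sum_reindex:
  assumes "bij_betw h A B"
  shows "abs_has_sum (\<lambda>k. t (h k)) A s \<longleftrightarrow> abs_has_sum t B s"
  unfolding abs_has_sum_def
  using has_sum_reindex_bij_betw[OF assms, of t s]
    summable_on_reindex_bij_betw[OF assms, of "\<lambda>k. norm (t k)"] by simp

lemma abs_has_sum_add:
  assumes "abs_has_sum a A s" "abs_has_sum b A t"
  shows "abs_has_sum (\<lambda>k. a k + b k) A (s + t)"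
proof -
  have "(\<lambda>k. norm (a k) + norm (b k)) summable_on A"
    using assms by (auto simp: abs_has_sum_def intro: summable_on_add)
  then have "(\<lambda>k. norm (a k + b k)) summable_on A"
    by (rule summable_on_comparison_test) (auto simp: norm_triangle_ineq)
  then show ?thesis using assms by (auto simp: abs_has_sum_def intro: has_sum_add)
qed

text \<open>Fubini with \<open>N\<close> as the outer index; the factor \<open>s powi N\<close> is
  constant along a row and nonzero, so it can be cancelled there.\<close>

lemma abs_has_sum_by_rows:
  assumes "abs_has_sum (\<lambda>(k, N). a k N * s powi N) UNIV G" and s: "s \<noteq> (0::complex)"
  shows "(\<lambda>k. norm (a k N)) summable_on UNIV"
    and "((\<lambda>N. (\<Sum>\<^sub>\<infinity>k. a k N) * s powi N) has_sum G) UNIV"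
proof -
  define t where "t = (\<lambda>(N, k). a k N * s powi N)"
  have "bij_betw prod.swap (UNIV :: (int \<times> 'a) set) UNIV" by (simp add: bij_betw_def)
  from abs_has_sum_reindex[OF this, of "\<lambda>(k, N). a k N * s powi N" G]
  have t: "abs_has_sum t UNIV G"
    using assms(1) unfolding t_def case_prod_beta by simp
  then have abs: "(\<lambda>p. norm (t p)) summable_on (SIGMA N:UNIV. UNIV)"
    and hs: "(t has_sum G) (SIGMA N:UNIV. UNIV)" by (simp_all add: abs_has_sum_def)
  have row: "(\<lambda>k. norm (t (N, k))) summable_on UNIV" for N
    by (rule abs[unfolded Infinite_Sum.abs_summable_on_Sigma_iff, THEN conjunct1, rule_format]) simp
  have "(\<lambda>k. norm (t (N, k)) * norm (inverse (s powi N))) summable_on UNIV" for N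
    by (rule summable_on_cmult_left[OF row])
  moreover have "norm (t (N, k)) * norm (inverse (s powi N)) = norm (a k N)" for N k
    using s by (simp add: t_def norm_mult norm_inverse)
  ultimately show *: "(\<lambda>k. norm (a k N)) summable_on UNIV" for N by simp
  have "((\<lambda>k. t (N, k)) has_sum (\<Sum>\<^sub>\<infinity>k. a k N) * s powi N) UNIV" for N
    unfolding t_def using has_sum_cmult_left[OF has_sum_infsum[OF abs_summable_summable[OF *]]]
    by simp
  from has_sum_SigmaD[OF hs this]
  show "((\<lambda>N. (\<Sum>\<^sub>\<infinity>k. a k N) * s powi N) has_sum G) UNIV" by simp
qed

text \<open>The Cauchy product: the products are absolutely summable over all pairs and may be
  regrouped by total index. The index type is a general abelian group in order to cover pairs of
  integer exponents.\<close>

lemma abs_has_sum_convolution: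
  fixes a b :: "'g::ab_group_add \<Rightarrow> complex"
  assumes a: "abs_has_sum a UNIV s" and b: "abs_has_sum b UNIV t"
  shows "abs_has_sum (\<lambda>l. \<Sum>\<^sub>\<infinity>k. a k * b (l - k)) UNIV (s * t)"
proof -
  define c where "c = (\<lambda>(k, l). a k * b l)"
  have na: "(\<lambda>k. norm (a k)) summable_on UNIV" and nb: "(\<lambda>k. norm (b k)) summable_on UNIV"
    using a b by (simp_all add: abs_has_sum_def)
  have "(\<lambda>k. norm (a k) * (\<Sum>\<^sub>\<infinity>l. norm (b l))) summable_on UNIV"
    by (rule summable_on_cmult_left[OF na])
  then have abs: "(\<lambda>p. norm (c p)) summable_on UNIV \<times> UNIV"
    unfolding Infinite_Sum.abs_summable_on_Sigma_iff c_def using summable_on_cmult_right[OF nb]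
    by (simp add: norm_mult infsum_cmult_right' abs_mult infsum_nonneg)
  have "((\<lambda>k. a k * t) has_sum s * t) UNIV"
    using a by (auto simp: abs_has_sum_def intro: has_sum_cmult_left)
  moreover have "((\<lambda>l. c (k, l)) has_sum a k * t) UNIV" for k
    using b by (auto simp: abs_has_sum_def c_def intro: has_sum_cmult_right)
  ultimately have "(c has_sum s * t) (UNIV \<times> UNIV)"
    by (intro has_sum_SigmaI[where g = "\<lambda>k. a k * t"] abs_summable_summable[OF abs]) auto
  with abs have c: "abs_has_sum c UNIV (s * t)" by (simp add: abs_has_sum_def)
  \<comment> \<open>This shear makes the total index \<open>l\<close> the outer summation
    variable.\<close>
  have "bij (\<lambda>(l, k). (k, l - k :: 'g))"
    by (rule o_bij[where g = "\<lambda>(k, l). (k + l, k)"]) (auto simp: fun_eq_iff)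
  from abs_has_sum_reindex[OF this, of c] c
  have d: "abs_has_sum (\<lambda>(l, k). a k * b (l - k)) UNIV (s * t)"
    unfolding c_def case_prod_unfold by simp
  then have abs': "(\<lambda>p. norm ((\<lambda>(l, k). a k * b (l - k)) p)) summable_on (SIGMA l:UNIV. UNIV)"
    and hs': "((\<lambda>(l, k). a k * b (l - k)) has_sum s * t) (SIGMA l:UNIV. UNIV)"
    by (simp_all add: abs_has_sum_def)
  note row = abs'[unfolded Infinite_Sum.abs_summable_on_Sigma_iff]
  have r1: "(\<lambda>k. norm (a k * b (l - k))) summable_on UNIV" for l using row by auto
  have r2: "(\<lambda>l. \<Sum>\<^sub>\<infinity>k. norm (a k * b (l - k))) summable_on UNIV"
    using row by (auto simp: infsum_nonneg)
  have "(\<lambda>l. norm (\<Sum>\<^sub>\<infinity>k. a k * b (l - k))) summable_on UNIV"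
    by (rule summable_on_comparison_test[OF r2]) (auto intro: norm_infsum_bound r1)
  moreover have "((\<lambda>l. \<Sum>\<^sub>\<infinity>k. a k * b (l - k)) has_sum s * t) UNIV"
    by (rule has_sum_SigmaD[OF hs']) (auto intro!: has_sum_infsum abs_summable_summable[OF r1])
  ultimately show ?thesis by (simp add: abs_has_sum_def)
qed

section \<open>Uniqueness of Laurent coefficients bounded below\<close>

text \<open>Multiplying by \<open>s powi (-m)\<close> gives a power series \<open>b\<close> in
  \<open>s\<close>, whose coefficients are shown to vanish one after another. Small positive real
  \<open>s\<close> suffice for this.\<close>

lemma laurent_coeff_zero:
  fixes a :: "int \<Rightarrow> complex"
  assumes m: "\<And>k. k < m \<Longrightarrow> a k = 0" and e: "0 < e"
    and sum: "\<And>s::real. 0 < s \<Longrightarrow> s < e \<Longrightarrow> ((\<lambda>k. a k * of_real s powi k) has_sum 0) UNIV"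
  shows "a k = 0"
proof -
  define b where "b n = a (m + int n)" for n
  have bs: "(\<lambda>n. b n * of_real s ^ n) sums 0" if s: "0 < s" "s < e" for s :: real
  proof -
    have "((\<lambda>k. a k * of_real s powi k) has_sum 0) {m..}"
      using sum[OF s] by (rule has_sum_cong_neutral[THEN iffD1, rotated -1]) (auto simp: m)
    moreover have "bij_betw (\<lambda>n. m + int n) UNIV {m..}"
      by (rule bij_betwI[where g = "\<lambda>k. nat (k - m)"]) auto
    ultimately have "((\<lambda>n. a (m + int n) * of_real s powi (m + int n)) has_sum 0) UNIV"
      by (subst has_sum_reindex_bij_betw)
    then have "((\<lambda>n. a (m + int n) * of_real s powi (m + int n) * of_real s powi (-m)) has_sum
       0 * of_real s powi (-m)) UNIV" by (rule has_sum_cmult_left)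
    moreover have "a (m + int n) * of_real s powi (m + int n) * of_real s powi (-m) =
        b n * of_real s ^ n" for n
      using s by (simp add: b_def power_int_add power_int_minus)
    ultimately show ?thesis using has_sum_imp_sums by simp
  qed
  have "b n = 0" for n
  proof (induction n rule: less_induct)
    case (less n)
    \<comment> \<open>The earlier coefficients vanish, so division by \<open>s ^ n\<close> leaves a
      power series with constant term \<open>b n\<close>. Its sum is 0 for small positive
      \<open>s\<close>, and its limit at 0 is \<open>b n\<close>.\<close>
    define f where "f x = (\<Sum>i. b (i + n) * x ^ i)" for x
    have sm: "(\<lambda>i. b (i + n) * of_real s ^ i) sums 0" if s: "0 < s" "s < e" for s :: real
    proof -
      have "(\<lambda>i. b (i + n) * of_real s ^ (i + n)) sums 0"
        using sums_iff_shift'[of "\<lambda>i. b i * of_real s ^ i" n 0] bs[OF s] less by simp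
      then have "(\<lambda>i. b (i + n) * of_real s ^ (i + n) * inverse (of_real s ^ n)) sums
          (0 * inverse (of_real s ^ n))" by (rule sums_mult2)
      then show ?thesis using s by (simp add: power_add field_simps)
    qed
    \<comment> \<open>Convergence at the single point \<open>e / 2\<close> gives convergence in the
      open disc of that radius.\<close>
    have "summable (\<lambda>i. b (i + n) * x ^ i)" if "norm x < e / 2" for x :: complex
      by (rule powser_inside[OF sums_summable[OF sm[of "e / 2"]]]) (use e that in auto)
    then have "(f \<longlongrightarrow> b (0 + n)) (at 0)"
      by (intro powser_limit_0[where s = "e / 2"]) (use e in \<open>auto simp: f_def summable_sums\<close>)
    moreover have "filterlim (\<lambda>s::real. of_real s :: complex) (at 0) (at_right 0)"
      unfolding filterlim_at
    proof
      have "((\<lambda>s::real. of_real s :: complex) \<longlongrightarrow> of_real 0) (at_right 0)"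
        by (rule tendsto_of_real[OF tendsto_ident_at])
      then show "((\<lambda>s::real. of_real s :: complex) \<longlongrightarrow> 0) (at_right 0)" by simp
      show "\<forall>\<^sub>F s::real in at_right 0. of_real s \<in> UNIV \<and> (of_real s :: complex) \<noteq> 0"
        using eventually_at_right_less[of "0::real"] by (rule eventually_mono) simp
    qed
    ultimately have "((\<lambda>s::real. f (of_real s)) \<longlongrightarrow> b n) (at_right 0)"
      using filterlim_compose[of f "nhds (b n)" "at 0"] by simp
    moreover have "\<forall>\<^sub>F s::real in at_right 0. f (of_real s) = 0"
      using eventually_at_right_less[of 0] eventually_at_right_real[OF e]
      by eventually_elim (use sm in \<open>auto simp: f_def sums_iff\<close>)
    then have "((\<lambda>s::real. f (of_real s)) \<longlongrightarrow> 0) (at_right 0)" by (rule tendsto_eventually)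
    ultimately show ?case by (rule tendsto_unique[OF trivial_limit_at_right_real])
  qed
  from this[of "nat (k - m)"] show ?thesis using m[of k] by (cases "k < m") (auto simp: b_def)
qed

text \<open>This is what separates total degrees, through powers of \<open>s\<close>, and later
  single coefficients, through powers of \<open>t\<close>. The common sum \<open>G\<close> is left
  existential because only the equality of the two sums matters.\<close>

lemma laurent_coeff_unique:
  fixes a b :: "int \<Rightarrow> complex"
  assumes "\<And>k. k < m \<Longrightarrow> a k = 0" "\<And>k. k < m' \<Longrightarrow> b k = 0" "0 < e"
    and "\<And>s::real. 0 < s \<Longrightarrow> s < e \<Longrightarrow>
      \<exists>G. ((\<lambda>k. a k * of_real s powi k) has_sum G) UNIV \<and>
          ((\<lambda>k. b k * of_real s powi k) has_sum G) UNIV"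
  shows "a k = b k"
proof -
  have hs: "((\<lambda>k. (a k - b k) * of_real s powi k) has_sum 0) UNIV" if s: "0 < s" "s < e" for s :: real
  proof -
    obtain G where G: "((\<lambda>k. a k * of_real s powi k) has_sum G) UNIV"
          "((\<lambda>k. b k * of_real s powi k) has_sum G) UNIV" using assms(4)[OF s] by blast
    have "((\<lambda>k. - (b k * of_real s powi k)) has_sum - G) UNIV"
      using G(2) by (simp add: has_sum_uminus)
    from has_sum_add[OF G(1) this] show ?thesis by (simp add: algebra_simps)
  qed
  have "a k - b k = 0"
    by (rule laurent_coeff_zero[of "min m m'" "\<lambda>k. a k - b k" e])
      (simp_all add: assms(1-3) hs)
  then show ?thesis by simp
qed

section \<open>Functions with a two-variable Laurent expansion\<close>

text \<open>With \<open>t = (z\<^sub>1 - z\<^sub>2) / z\<^sub>2\<close> and \<open>s = 1 / z\<^sub>2\<close>, this is \<open>|z\<^sub>2| > |z\<^sub>1 - z\<^sub>2| + |z|\<close> for \<open>z \<in> Z\<close>.\<close>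

definition laurent_region :: "complex set \<Rightarrow> (complex \<times> complex) set" where
  "laurent_region Z =
     {(t, s). t \<noteq> 0 \<and> s \<noteq> 0 \<and> norm t < 1 \<and> (\<forall>z\<in>Z. norm t + norm (z * s) < 1)}"

text \<open>The bound \<open>m\<close> on both exponents is what permits
  \<open>laurent_coeff_unique\<close> to be applied first in \<open>s\<close> and then in
  \<open>t\<close>.\<close>

definition laurent_coeffs ::
    "complex set \<Rightarrow> (complex \<Rightarrow> complex \<Rightarrow> complex) \<Rightarrow> (int \<times> int \<Rightarrow> complex) \<Rightarrow> int \<Rightarrow> bool" where
  "laurent_coeffs Z H e m \<longleftrightarrow>
     (\<forall>k N. e (k, N) \<noteq> 0 \<longrightarrow> m \<le> k \<and> m \<le> N) \<and>
     (\<forall>(t, s)\<in>laurent_region Z. abs_has_sum (\<lambda>l. e l * (t powi fst l * s powi snd l)) UNIV (H t s))"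

definition laurent_expandable :: "complex set \<Rightarrow> (complex \<Rightarrow> complex \<Rightarrow> complex) \<Rightarrow> bool" where
  "laurent_expandable Z H \<longleftrightarrow> (\<exists>e m. laurent_coeffs Z H e m)"

lemma laurent_expandableI [intro?]: "laurent_coeffs Z H e m \<Longrightarrow> laurent_expandable Z H"
  by (auto simp: laurent_expandable_def)

lemma laurent_expandable_cong:
  assumes "\<And>t s. t \<noteq> 0 \<Longrightarrow> s \<noteq> 0 \<Longrightarrow> H t s = H' t s"
  shows "laurent_expandable Z H \<longleftrightarrow> laurent_expandable Z H'"
  using assms by (simp add: laurent_expandable_def laurent_coeffs_def laurent_region_def)

lemma laurent_expandable_monomial: "laurent_expandable Z (\<lambda>t s. c * t powi k * s powi N)"
proof
  show "laurent_coeffs Z (\<lambda>t s. c * t powi k * s powi N) (\<lambda>l. if l = (k, N) then c else 0) (min k N)"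
    unfolding laurent_coeffs_def
  proof (intro conjI ballI, goal_cases)
    case (2 p)
    obtain t s where p: "p = (t, s)" by (cases p)
    have "((\<lambda>l. (if l = (k, N) then c else 0) * (t powi fst l * s powi snd l)) has_sum
        c * t powi k * s powi N) UNIV"
      by (rule has_sum_finite_neutralI[of "{(k, N)}"]) auto
    moreover have "(\<lambda>l. norm ((if l = (k, N) then c else 0) * (t powi fst l * s powi snd l)))
        summable_on UNIV"
      by (rule finite_nonzero_values_imp_summable_on, rule finite_subset[of _ "{(k, N)}"]) auto
    ultimately show ?case by (simp add: p abs_has_sum_def)
  qed auto
qed

lemma laurent_expandable_const: "laurent_expandable Z (\<lambda>t s. c)"
  using laurent_expandable_monomial[of Z c 0 0] by simp

lemma laurent_expandable_add:
  assumes "laurent_expandable Z H" "laurent_expandable Z H'"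
  shows "laurent_expandable Z (\<lambda>t s. H t s + H' t s)"
proof -
  obtain e m e' m' where e: "laurent_coeffs Z H e m" and e': "laurent_coeffs Z H' e' m'"
    using assms by (auto simp: laurent_expandable_def)
  have "laurent_coeffs Z (\<lambda>t s. H t s + H' t s) (\<lambda>l. e l + e' l) (min m m')"
    unfolding laurent_coeffs_def
  proof (intro conjI ballI, goal_cases)
    case 1
    have "m \<le> k \<and> m \<le> N \<or> m' \<le> k \<and> m' \<le> N" if "e (k, N) + e' (k, N) \<noteq> 0" for k N
      using e e' that unfolding laurent_coeffs_def by (metis add.right_neutral)
    then show ?case by fastforce
  next
    case (2 p)
    then show ?case using e e'
      by (force simp: laurent_coeffs_def distrib_right intro: abs_has_sum_add)
  qed
  then show ?thesis ..
qed

text \<open>Monomials in \<open>t\<close> and \<open>s\<close> are multiplicative in the exponent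
  pair, so coefficients convolve over \<open>int \<times> int\<close> and the lower bounds
  add.\<close>

lemma laurent_expandable_mult:
  assumes "laurent_expandable Z H" "laurent_expandable Z H'"
  shows "laurent_expandable Z (\<lambda>t s. H t s * H' t s)"
proof -
  obtain e m e' m' where e: "laurent_coeffs Z H e m" and e': "laurent_coeffs Z H' e' m'"
    using assms by (auto simp: laurent_expandable_def)
  define c where "c = (\<lambda>l. \<Sum>\<^sub>\<infinity>k. e k * e' (l - k))"
  have "laurent_coeffs Z (\<lambda>t s. H t s * H' t s) c (m + m')"
    unfolding laurent_coeffs_def
  proof (intro conjI ballI allI impI, goal_cases)
    \<comment> \<open>A nonzero infinite sum has a nonzero summand, whose two factors obey their
      respective bounds.\<close>
    case (1 k N)
    then obtain l where l: "e l * e' ((k, N) - l) \<noteq> 0"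
      unfolding c_def by (metis (no_types, lifting) infsum_0)
    obtain l1 l2 where [simp]: "l = (l1, l2)" by (cases l)
    have "m \<le> l1" "m' \<le> k - l1" using l e e' by (auto simp: laurent_coeffs_def)
    then show ?case by simp
  next
    case (2 k N)
    then obtain l where l: "e l * e' ((k, N) - l) \<noteq> 0"
      unfolding c_def by (metis (no_types, lifting) infsum_0)
    obtain l1 l2 where [simp]: "l = (l1, l2)" by (cases l)
    have "m \<le> l2" "m' \<le> N - l2" using l e e' by (auto simp: laurent_coeffs_def)
    then show ?case by simp
  next
    case (3 p)
    obtain t s where p: "p = (t, s)" by (cases p)
    then have ts: "t \<noteq> 0" "s \<noteq> 0" using 3 by (auto simp: laurent_region_def)
    define \<mu> where "\<mu> = (\<lambda>l :: int \<times> int. t powi fst l * s powi snd l)"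
    have \<mu>: "\<mu> k * \<mu> (l - k) = \<mu> l" for k l
    proof -
      have "\<mu> k * \<mu> (l - k) = (t powi fst k * t powi (fst l - fst k)) * (s powi snd k * s powi (snd l - snd k))"
        by (simp add: \<mu>_def mult_ac)
      then show ?thesis using ts by (simp add: \<mu>_def flip: power_int_add)
    qed
    have "abs_has_sum (\<lambda>l. e l * \<mu> l) UNIV (H t s)" "abs_has_sum (\<lambda>l. e' l * \<mu> l) UNIV (H' t s)"
      using 3 e e' by (auto simp: laurent_coeffs_def p \<mu>_def)
    from abs_has_sum_convolution[OF this]
    have "abs_has_sum (\<lambda>l. \<Sum>\<^sub>\<infinity>k. (e k * \<mu> k) * (e' (l - k) * \<mu> (l - k))) UNIV (H t s * H' t s)" .
    moreover have "(e k * \<mu> k) * (e' (l - k) * \<mu> (l - k)) = (e k * e' (l - k)) * \<mu> l" for k l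
      using \<mu>[of k l] by (metis mult.assoc mult.left_commute)
    ultimately have "abs_has_sum (\<lambda>l. c l * \<mu> l) UNIV (H t s * H' t s)"
      by (simp add: c_def infsum_cmult_left')
    then show ?case by (simp add: p \<mu>_def)
  qed
  then show ?thesis ..
qed

lemma laurent_expandable_power:
  assumes "laurent_expandable Z H" shows "laurent_expandable Z (\<lambda>t s. H t s ^ n)"
  by (induction n) (auto intro: laurent_expandable_const laurent_expandable_mult assms)

lemma laurent_expandable_prod:
  assumes "\<And>i. i \<in> A \<Longrightarrow> laurent_expandable Z (H i)"
  shows "laurent_expandable Z (\<lambda>t s. \<Prod>i\<in>A. H i t s)"
  using assms
  by (induction A rule: infinite_finite_induct)
    (auto intro: laurent_expandable_const laurent_expandable_mult)

lemma laurent_expandable_sum: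
  assumes "\<And>i. i \<in> A \<Longrightarrow> laurent_expandable Z (H i)"
  shows "laurent_expandable Z (\<lambda>t s. \<Sum>i\<in>A. H i t s)"
  using assms
  by (induction A rule: infinite_finite_induct)
    (auto intro: laurent_expandable_const laurent_expandable_add)

section \<open>Geometric series in two variables\<close>

text \<open>The geometric series in \<open>A + B\<close> is expanded by the binomial theorem, with
  \<open>n = q + p\<close> as row index. The row sums of norms are the powers of
  \<open>norm A + norm B\<close>, so the hypothesis is exactly what absolute convergence
  needs.\<close>

lemma abs_has_sum_binomial_series:
  fixes A B :: complex
  assumes AB: "norm A + norm B < 1"
  shows "abs_has_sum (\<lambda>(q, p). of_nat (q + p choose q) * A ^ q * B ^ p) UNIV (inverse (1 - (A + B)))"
proof -
  define g where "g = (\<lambda>(n, q). of_nat (n choose q) * A ^ q * B ^ (n - q))"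
  let ?S = "SIGMA n:UNIV. {..n :: nat}"
  have row: "(\<Sum>q\<le>n. g (n, q)) = (A + B) ^ n" for n
    by (simp add: g_def binomial_ring)
  have nrow: "(\<Sum>\<^sub>\<infinity>q\<in>{..n}. norm (g (n, q))) = (norm A + norm B) ^ n" for n
    by (simp add: g_def binomial_ring norm_mult norm_power)
  have geo: "((\<lambda>n. x ^ n) has_sum inverse (1 - x)) UNIV" and geo_abs: "(\<lambda>n. norm (x ^ n)) summable_on UNIV"
    if "norm x < 1" for x :: complex
    using that norm_summable_imp_has_sum[of "\<lambda>n. x ^ n" "inverse (1 - x)"]
      norm_summable_imp_summable_on[of "\<lambda>n. norm (x ^ n)"] geometric_sums[of x]
    by (simp_all add: norm_power inverse_eq_divide)
  have "(\<lambda>n. norm (complex_of_real (norm A + norm B) ^ n)) summable_on UNIV"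
    by (rule geo_abs) (use AB in \<open>simp flip: of_real_add\<close>)
  then have "(\<lambda>n. (norm A + norm B) ^ n) summable_on UNIV"
    by (simp add: norm_power flip: of_real_add)
  then have abs: "(\<lambda>p. norm (g p)) summable_on ?S"
    unfolding Infinite_Sum.abs_summable_on_Sigma_iff by (simp add: nrow norm_power)
  have "norm (A + B) < 1" using AB norm_triangle_ineq[of A B] by simp
  from geo[OF this] have "((\<lambda>n. (A + B) ^ n) has_sum inverse (1 - (A + B))) UNIV" .
  then have "(g has_sum inverse (1 - (A + B))) ?S"
    by (rule has_sum_SigmaI[rotated]) (auto simp: has_sum_finite_iff row abs_summable_summable[OF abs])
  with abs have "abs_has_sum g ?S (inverse (1 - (A + B)))" by (simp add: abs_has_sum_def)
  moreover have "bij_betw (\<lambda>(q, p). (q + p, q)) UNIV ?S"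
    by (rule bij_betwI[where g = "\<lambda>(n, q). (q, n - q)"]) auto
  ultimately have "abs_has_sum (\<lambda>l. g ((\<lambda>(q, p). (q + p, q)) l)) UNIV (inverse (1 - (A + B)))"
    by (simp add: abs_has_sum_reindex)
  then show ?thesis by (simp add: g_def case_prod_unfold)
qed

text \<open>The two uses are \<open>d = 1\<close>, since z1 - z = (1 + t - z s) / s, and
  \<open>d = 0\<close>, since z2 - z = (1 - z s) / s. Both are cases of the binomial series with A =
  - d t and B = z s.\<close>

lemma laurent_expandable_geometric:
  assumes z: "z \<in> Z" and d: "norm d \<le> 1"
  shows "laurent_expandable Z (\<lambda>t s. inverse (1 + d * t - z * s))"
proof
  let ?e = "\<lambda>(k, N). if 0 \<le> k \<and> 0 \<le> N
    then of_nat (nat k + nat N choose nat k) * (- d) ^ nat k * z ^ nat N else 0"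
  show "laurent_coeffs Z (\<lambda>t s. inverse (1 + d * t - z * s)) ?e 0"
    unfolding laurent_coeffs_def
  proof (intro conjI ballI, goal_cases)
    case (2 p)
    obtain t s where p: "p = (t, s)" by (cases p)
    have "norm (- d * t) \<le> norm t" using d by (simp add: norm_mult mult_left_le_one_le)
    then have "norm (- d * t) + norm (z * s) < 1" using 2 z by (force simp: p laurent_region_def)
    from abs_has_sum_binomial_series[OF this]
    have 1: "abs_has_sum (\<lambda>(q, p). of_nat (q + p choose q) * (- d * t) ^ q * (z * s) ^ p) UNIV
        (inverse (1 + d * t - z * s))" by (simp add: algebra_simps)
    let ?g = "\<lambda>l. ?e l * (t powi fst l * s powi snd l)"
    \<comment> \<open>The natural exponents of the series become the nonnegative quadrant of integer
      exponents, outside of which \<open>?e\<close> is 0.\<close>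
    have bij: "bij_betw (map_prod int int) UNIV ({0..} \<times> {0..})"
      by (rule bij_betwI[where g = "map_prod nat nat"]) auto
    have "abs_has_sum (\<lambda>l. ?g (map_prod int int l)) UNIV (inverse (1 + d * t - z * s))"
      using 1 by (simp add: case_prod_unfold power_mult_distrib[of "- d" t, simplified] power_mult_distrib mult_ac)
    then have "abs_has_sum ?g ({0..} \<times> {0..}) (inverse (1 + d * t - z * s))"
      by (rule abs_has_sum_reindex[OF bij, THEN iffD1])
    moreover have "(\<lambda>l. norm (?g l)) summable_on UNIV \<longleftrightarrow> (\<lambda>l. norm (?g l)) summable_on ({0..} \<times> {0..})"
      by (rule summable_on_cong_neutral) auto
    moreover have "(?g has_sum S) UNIV \<longleftrightarrow> (?g has_sum S) ({0..} \<times> {0..})" for S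
      by (rule has_sum_cong_neutral) auto
    ultimately show ?case by (simp add: p abs_has_sum_def)
  qed auto
qed

section \<open>Rational functions of several variables\<close>

lemma laurent_expandable_polynomial:
  assumes "polynomial_fun n p" "\<And>t s. length (F t s) = n"
    and F: "\<And>i. i < n \<Longrightarrow> laurent_expandable Z (\<lambda>t s. F t s ! i)"
  shows "laurent_expandable Z (\<lambda>t s. p (F t s))"
proof -
  obtain M c where p: "\<And>zs. length zs = n \<Longrightarrow> p zs = (\<Sum>e\<in>M. c e * (\<Prod>i<n. zs ! i ^ (e ! i)))"
    using assms(1) unfolding polynomial_fun_def by blast
  show ?thesis
    unfolding p[OF assms(2)]
    by (intro laurent_expandable_sum laurent_expandable_mult laurent_expandable_prod
        laurent_expandable_const laurent_expandable_power F) simp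
qed

text \<open>The list is (z1, z2, z3, ...) written in \<open>t\<close> and \<open>s\<close>. Each
  possible pole factor has an expandable inverse: z1 - z2 = t / s is a monomial, differences of z1
  or z2 with an entry of \<open>xs\<close> lead to geometric series, and differences within
  \<open>xs\<close> are constants.\<close>

lemma laurent_expandable_rational:
  assumes p: "polynomial_fun (n + 2) p" and xs: "length xs = n"
  shows "laurent_expandable (set xs) (\<lambda>t s.
    p ((1 + t) / s # 1 / s # xs) / difference_product (n + 2) (\<lambda>i j. int (b i j)) ((1 + t) / s # 1 / s # xs))"
proof -
  let ?Z = "set xs" and ?F = "\<lambda>t s :: complex. (1 + t) / s # 1 / s # xs"
  have 0: "laurent_expandable ?Z (\<lambda>t s. (1 + t) / s)"
  proof -
    have "laurent_expandable ?Z (\<lambda>t s. 1 * t powi 0 * s powi (-1) + 1 * t powi 1 * s powi (-1))"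
      by (intro laurent_expandable_add laurent_expandable_monomial)
    then show ?thesis
      by (subst laurent_expandable_cong) (auto simp: power_int_minus field_simps)
  qed
  have 1: "laurent_expandable ?Z (\<lambda>t s. 1 / s)"
    using laurent_expandable_monomial[of ?Z 1 0 "-1"] by (simp add: power_int_minus field_simps)
  have s: "laurent_expandable ?Z (\<lambda>t s. s)"
    using laurent_expandable_monomial[of ?Z 1 0 1] by simp
  have pole: "laurent_expandable ?Z (\<lambda>t s. inverse (?F t s ! i - ?F t s ! j))"
    if ij: "i < j" "j < n + 2" for i j
  proof -
    have z: "j = Suc (Suc k) \<Longrightarrow> xs ! k \<in> ?Z" for k using ij xs by auto
    consider "i = 0" "j = 1" | k where "i = 0" "j = Suc (Suc k)" | k where "i = 1" "j = Suc (Suc k)"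
      | k l where "i = Suc (Suc k)" "j = Suc (Suc l)"
      using ij(1) by (metis One_nat_def less_Suc0 not0_implies_Suc not_less_eq not_less_zero)
    then show ?thesis
    proof cases
      case 1
      then show ?thesis
        using laurent_expandable_monomial[of ?Z 1 "-1" 1]
        by (subst laurent_expandable_cong[where H' = "\<lambda>t s. 1 * t powi (-1) * s powi 1"])
          (auto simp: power_int_minus field_simps)
    next
      case 2
      have "laurent_expandable ?Z (\<lambda>t s. s * inverse (1 + 1 * t - xs ! k * s))"
        using z[OF 2(2)] by (intro laurent_expandable_mult s laurent_expandable_geometric) auto
      moreover have "s * inverse (1 + 1 * t - xs ! k * s) = inverse (?F t s ! i - ?F t s ! j)"
        if "s \<noteq> 0" for s t
      proof -
        have "?F t s ! i - ?F t s ! j = (1 + 1 * t - xs ! k * s) / s" using that 2 by (simp add: field_simps)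
        then show ?thesis by (simp only: inverse_divide) (simp add: divide_inverse)
      qed
      ultimately show ?thesis by (subst (asm) laurent_expandable_cong) auto
    next
      case 3
      have "laurent_expandable ?Z (\<lambda>t s. s * inverse (1 + 0 * t - xs ! k * s))"
        using z[OF 3(2)] by (intro laurent_expandable_mult s laurent_expandable_geometric) auto
      moreover have "s * inverse (1 + 0 * t - xs ! k * s) = inverse (?F t s ! i - ?F t s ! j)"
        if "s \<noteq> 0" for s t
      proof -
        have "?F t s ! i - ?F t s ! j = (1 + 0 * t - xs ! k * s) / s" using that 3 by (simp add: field_simps)
        then show ?thesis by (simp only: inverse_divide) (simp add: divide_inverse)
      qed
      ultimately show ?thesis by (subst (asm) laurent_expandable_cong) auto
    qed (simp add: laurent_expandable_const)
  qed
  have "laurent_expandable ?Z (\<lambda>t s. p (?F t s) *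
      (\<Prod>j<n + 2. \<Prod>i<j. inverse (?F t s ! i - ?F t s ! j) ^ b i j))"
  proof (intro laurent_expandable_mult laurent_expandable_prod laurent_expandable_power)
    show "laurent_expandable ?Z (\<lambda>t s. p (?F t s))"
    proof (rule laurent_expandable_polynomial[OF p])
      show "laurent_expandable ?Z (\<lambda>t s. ?F t s ! i)" for i
        by (cases i; cases "i - 1") (simp_all add: 0 1 laurent_expandable_const)
    qed (simp add: xs)
  qed (use pole in auto)
  also have "(\<lambda>t s. p (?F t s) * (\<Prod>j<n + 2. \<Prod>i<j. inverse (?F t s ! i - ?F t s ! j) ^ b i j)) =
      (\<lambda>t s. p (?F t s) / difference_product (n + 2) (\<lambda>i j. int (b i j)) (?F t s))"
    unfolding difference_product_def divide_inverse prod_inversef[symmetric] power_int_of_nat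
      power_inverse o_def ..
  finally show ?thesis .
qed

section \<open>Identity theorem for rational maps by restriction to lines\<close>

lemma polynomial_fun_on_line:
  assumes "polynomial_fun n p" "length as = n" "length bs = n"
  obtains q where "\<And>t. p (map2 (\<lambda>a b. a + t * (b - a)) as bs) = poly q t"
proof -
  obtain M c where p: "\<And>zs. length zs = n \<Longrightarrow> p zs = (\<Sum>e\<in>M. c e * (\<Prod>i<n. zs ! i ^ (e ! i)))"
    using assms(1) unfolding polynomial_fun_def by blast
  let ?q = "\<Sum>e\<in>M. smult (c e) (\<Prod>i<n. [:as ! i, bs ! i - as ! i:] ^ (e ! i))"
  show ?thesis
    by (rule that[of ?q]) (use assms in \<open>simp add: p poly_sum poly_prod\<close>)
qed

lemma difference_product_on_line:
  assumes "length as = n" "length bs = n"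
  obtains q where "\<And>t. difference_product n (\<lambda>i j. int (b i j)) (map2 (\<lambda>x y. x + t * (y - x)) as bs) = poly q t"
proof -
  let ?q = "\<Prod>j<n. \<Prod>i<j. ([:as ! i, bs ! i - as ! i:] - [:as ! j, bs ! j - as ! j:]) ^ b i j"
  show ?thesis
    by (rule that[of ?q]) (use assms in \<open>simp add: difference_product_def poly_prod algebra_simps\<close>)
qed

lemma difference_product_nonzero:
  "zs \<in> config n \<Longrightarrow> difference_product n b zs \<noteq> 0"
  by (auto simp: difference_product_def config_def nth_eq_iff_index_eq)

text \<open>An arbitrary configuration \<open>bs\<close> is joined to the base point
  \<open>as\<close> by a line that runs in \<open>S\<close> for small positive \<open>t\<close>.
  Restricted to it, the pairings are quotients of one-variable polynomials, so agreement for small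
  \<open>t\<close> carries over to \<open>t = 1\<close>.\<close>

lemma (in graded_vector_space) rational_maps_eqI:
  assumes g: "g \<in> rational_maps scl gr n" and h: "h \<in> rational_maps scl gr n"
    and as: "length as = n" and S: "S \<subseteq> config n"
    and line: "\<And>bs. length bs = n \<Longrightarrow>
      \<forall>\<^sub>F t::real in at_right 0. map2 (\<lambda>a b. a + of_real t * (b - a)) as bs \<in> S"
    and eq: "\<And>\<phi> zs. \<phi> \<in> graded_dual scl gr \<Longrightarrow> zs \<in> S \<Longrightarrow> pairing \<phi> (g zs) = pairing \<phi> (h zs)"
  shows "g = h"
proof
  fix bs
  have ext: "g \<in> config n \<rightarrow>\<^sub>E completion gr" "h \<in> config n \<rightarrow>\<^sub>E completion gr"
    using g h by (auto simp: rational_maps_def)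
  show "g bs = h bs"
  proof (cases "bs \<in> config n")
    case bs: True
    then have len: "length bs = n" by (simp add: config_def)
    show ?thesis
    proof (rule completion_eqI)
      show "g bs \<in> completion gr" "h bs \<in> completion gr" using ext bs by auto
      fix \<phi> assume \<phi>: "\<phi> \<in> graded_dual scl gr"
      let ?D = "\<lambda>b. difference_product n (\<lambda>i j. int (b i j))"
      obtain p b where p: "polynomial_fun n p" "\<And>zs. zs \<in> config n \<Longrightarrow> pairing \<phi> (g zs) = p zs / ?D b zs"
        using g \<phi> by (fastforce simp: rational_maps_def)
      obtain p' b' where p': "polynomial_fun n p'" "\<And>zs. zs \<in> config n \<Longrightarrow> pairing \<phi> (h zs) = p' zs / ?D b' zs"
        using h \<phi> by (fastforce simp: rational_maps_def)
      let ?L = "\<lambda>t. map2 (\<lambda>x y. x + t * (y - x)) as bs"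
      obtain q where q: "\<And>t. p (?L t) = poly q t" by (rule polynomial_fun_on_line[OF p(1) as len]) blast
      obtain q' where q': "\<And>t. p' (?L t) = poly q' t" by (rule polynomial_fun_on_line[OF p'(1) as len]) blast
      obtain d where d: "\<And>t. ?D b (?L t) = poly d t" by (rule difference_product_on_line[OF as len, of b]) blast
      obtain d' where d': "\<And>t. ?D b' (?L t) = poly d' t" by (rule difference_product_on_line[OF as len, of b']) blast
      obtain e :: real where e: "e > 0" "\<And>t. 0 < t \<Longrightarrow> t < e \<Longrightarrow> ?L (of_real t) \<in> S"
        using line[OF len] unfolding eventually_at_right_field by blast
      \<comment> \<open>Equality of the two fractions, cleared of denominators, becomes the
        vanishing of one polynomial on a whole interval.\<close>
      have "poly (q * d' - q' * d) (of_real t) = 0" if "0 < t" "t < e" for t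
      proof -
        have L: "?L (of_real t) \<in> S" using e that by blast
        then have c: "?L (of_real t) \<in> config n" using S by blast
        then have "p (?L (of_real t)) / ?D b (?L (of_real t)) = p' (?L (of_real t)) / ?D b' (?L (of_real t))"
          using eq[OF \<phi> L] p(2)[OF c] p'(2)[OF c] by simp
        moreover have "?D b (?L (of_real t)) \<noteq> 0" "?D b' (?L (of_real t)) \<noteq> 0"
          using c by (rule difference_product_nonzero)+
        ultimately show ?thesis unfolding q q' d d' by (simp add: field_simps)
      qed
      then have "of_real ` {0<..<e} \<subseteq> {x. poly (q * d' - q' * d) x = 0}" by auto
      moreover have "infinite (of_real ` {0<..<e} :: complex set)"
        using e(1) by (simp add: finite_image_iff inj_on_def)
      ultimately have "q * d' - q' * d = 0" using poly_roots_finite finite_subset by blast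
      \<comment> \<open>At \<open>t = 1\<close> the line is at \<open>bs\<close>, where the
        denominators are nonzero because \<open>bs\<close> is a configuration.\<close>
      then have "poly q 1 * poly d' 1 = poly q' 1 * poly d 1"
        by (metis eq_iff_diff_eq_0 poly_mult)
      then have "p (?L 1) * ?D b' (?L 1) = p' (?L 1) * ?D b (?L 1)" by (simp only: q q' d d')
      moreover have L1: "?L 1 = bs"
        by (rule nth_equalityI) (use as len in auto)
      ultimately have "p bs * ?D b' bs = p' bs * ?D b bs" by (simp only: L1)
      then show "pairing \<phi> (g bs) = pairing \<phi> (h bs)"
        unfolding p(2)[OF bs] p'(2)[OF bs]
        using difference_product_nonzero[OF bs, of "\<lambda>i j. int (b i j)"]
          difference_product_nonzero[OF bs, of "\<lambda>i j. int (b' i j)"]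
        by (rule frac_eq_eq[THEN iffD2, rotated 2])
    qed
  next
    case False
    then show ?thesis using ext by (metis PiE_arb)
  qed
qed

text \<open>The region is cut out by finitely many strict inequalities and inequations between
  continuous functions of the point, and each persists for small \<open>t\<close>.\<close>

lemma line_into_iterate_region:
  assumes as: "as \<in> iterate_region n" and len: "length bs = n + 2"
  shows "\<forall>\<^sub>F t::real in at_right 0. map2 (\<lambda>a b. a + of_real t * (b - a)) as bs \<in> iterate_region n"
proof -
  let ?L = "\<lambda>t::real. map2 (\<lambda>a b. a + of_real t * (b - a)) as bs"
  have la: "length as = n + 2" using as by (simp add: iterate_region_def config_def)
  have lim: "((\<lambda>t. ?L t ! i) \<longlongrightarrow> as ! i) (at_right 0)" if "i < n + 2" for i
  proof -
    have "((\<lambda>t::real. as ! i + of_real t * (bs ! i - as ! i)) \<longlongrightarrow> as ! i + of_real 0 * (bs ! i - as ! i))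
        (at_right 0)" by (intro tendsto_intros)
    then show ?thesis using that la len by simp
  qed
  have less: "\<forall>\<^sub>F t in F. f t < g t" if "(f \<longlongrightarrow> a) F" "(g \<longlongrightarrow> b) F" "a < b"
    for f g :: "real \<Rightarrow> real" and a b F
  proof -
    have "\<forall>\<^sub>F t in F. 0 < g t - f t"
      using tendsto_diff[OF that(2,1)] that(3) by (intro order_tendstoD(1)) auto
    then show ?thesis by simp
  qed
  have "\<forall>\<^sub>F t in at_right 0. ?L t ! i \<noteq> ?L t ! j" if "i \<in> {..<n + 2}" "j \<in> {..<i}" for i j
  proof -
    have "as ! i - as ! j \<noteq> 0" using as that by (auto simp: iterate_region_def config_def nth_eq_iff_index_eq)
    moreover have "((\<lambda>t. ?L t ! i - ?L t ! j) \<longlongrightarrow> as ! i - as ! j) (at_right 0)"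
      using that by (intro tendsto_diff lim) auto
    ultimately have "\<forall>\<^sub>F t in at_right 0. ?L t ! i - ?L t ! j \<noteq> 0"
      by (rule tendsto_imp_eventually_ne[rotated])
    then show ?thesis by simp
  qed
  then have "\<forall>\<^sub>F t in at_right 0. \<forall>i\<in>{..<n + 2}. \<forall>j\<in>{..<i}. ?L t ! i \<noteq> ?L t ! j"
    by (intro eventually_ball_finite ballI) auto
  moreover have "\<forall>\<^sub>F t in at_right 0. norm (?L t ! 1) < norm (?L t ! 0)"
    by (rule less[OF tendsto_norm[OF lim] tendsto_norm[OF lim]]) (use as in \<open>auto intro!: tendsto_norm lim simp del: nth_map simp: iterate_region_def\<close>)
  moreover have "\<forall>\<^sub>F t in at_right 0. \<forall>i\<in>{2..<n + 2}. norm (?L t ! 0 - ?L t ! 1) + norm (?L t ! i) < norm (?L t ! 1)"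
  proof (intro eventually_ball_finite ballI)
    fix i assume i: "i \<in> {2..<n + 2}"
    show "\<forall>\<^sub>F t in at_right 0. norm (?L t ! 0 - ?L t ! 1) + norm (?L t ! i) < norm (?L t ! 1)"
    proof (rule less)
      show "((\<lambda>t. norm (?L t ! 0 - ?L t ! 1) + norm (?L t ! i)) \<longlongrightarrow>
          norm (as ! 0 - as ! 1) + norm (as ! i)) (at_right 0)"
        using i by (intro tendsto_intros lim) auto
      show "((\<lambda>t. norm (?L t ! 1)) \<longlongrightarrow> norm (as ! 1)) (at_right 0)"
        by (intro tendsto_intros lim) auto
    qed (use as i in \<open>auto simp: iterate_region_def\<close>)
  qed auto
  ultimately show ?thesis
  proof eventually_elim
    case (elim t)
    have "distinct (?L t)"
      unfolding distinct_conv_nth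
    proof (intro allI impI)
      fix i j assume "i < length (?L t)" "j < length (?L t)" "i \<noteq> j"
      then show "?L t ! i \<noteq> ?L t ! j"
        using elim(1)[rule_format, of i j] elim(1)[rule_format, of j i] la len
        by (cases "i < j") (simp_all del: nth_map)
    qed
    with elim show ?case by (simp add: iterate_region_def config_def la len)
  qed
qed

lemma iterate_region_nonempty: "\<exists>zs. zs \<in> iterate_region n"
proof
  \<comment> \<open>Here z1 - z2 = 1 and the remaining entries are 0, ..., n - 1, so the sum to be
    bounded is at most n, while z2 = n + 2.\<close>
  let ?zs = "map of_nat ((n + 3) # (n + 2) # [0..<n]) :: complex list"
  have nth: "?zs ! Suc (Suc i) = of_nat i" if "i < n" for i using that by simp
  show "?zs \<in> iterate_region n"
    unfolding iterate_region_def config_def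
  proof (intro CollectI conjI ballI)
    show "distinct ?zs" by (subst distinct_map) (auto simp: inj_on_def)
    fix i assume i: "i \<in> {2..<n + 2}"
    then obtain k where k: "i = Suc (Suc k)" "k < n"
      by (metis One_nat_def Suc_le_D Suc_le_mono add_2_eq_Suc' atLeastLessThan_iff not_less_eq numeral_2_eq_2)
    have "?zs ! 0 - ?zs ! 1 = 1" by simp
    then have "norm (?zs ! 0 - ?zs ! 1) + norm (?zs ! i) = 1 + real k"
      by (simp only: k(1) nth[OF k(2)] norm_of_nat norm_one)
    moreover have "norm (?zs ! 1) = real (n + 2)" by (simp only: list.map nth_Cons_Suc nth_Cons_0 One_nat_def norm_of_nat)
    ultimately show "norm (?zs ! 0 - ?zs ! 1) + norm (?zs ! i) < norm (?zs ! 1)" using k by simp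
  next
    have "norm (?zs ! 1) = real (n + 2)" "norm (?zs ! 0) = real (n + 3)"
      by (simp_all only: list.map nth_Cons_Suc nth_Cons_0 One_nat_def norm_of_nat)
    then show "norm (?zs ! 1) < norm (?zs ! 0)" by simp
  qed simp
qed

text \<open>With k1 = k and k2 = N - 2 - k, the exponents of \<open>s\<close> add up to (k1 + 1) +
  (k2 + 1) = N, which explains why N = k1 + k2 + 2 is the right total degree. It is used with a = 1
  + t for the product and a = t for the iterate.\<close>

lemma power_int_scale:
  fixes a s :: complex
  assumes "s \<noteq> 0"
  shows "(a / s) powi (- k - 1) * (1 / s) powi (- (N - 2 - k) - 1) = a powi (- k - 1) * s powi N"
proof -
  have "s powi (- k - 1) * s powi (- (N - 2 - k) - 1) = s powi (- N)"
    using assms by (simp flip: power_int_add)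
  moreover have "(a / s) powi (- k - 1) * (1 / s) powi (- (N - 2 - k) - 1) =
      a powi (- k - 1) / (s powi (- k - 1) * s powi (- (N - 2 - k) - 1))"
    by (simp only: power_int_divide_distrib power_int_1_left times_divide_times_eq mult_1_right)
  ultimately show ?thesis by (simp add: power_int_minus divide_inverse)
qed

section \<open>Degrees of the modes\<close>

context mosva
begin

text \<open>The bracket axiom makes the vector an eigenvector of the grading operator with
  eigenvalue a + b - k - 1.\<close>

lemma YV_degree_homogeneous:
  assumes u: "u \<in> grV a" and v: "v \<in> grV b" and i: "hom_comp grV (YV u k v) i \<noteq> 0"
  shows "i = a + b - k - 1"
proof -
  have "grading_op scaleV of_int grV (YV u k v) =
      scaleV (of_int (- k - 1)) (YV u k v) + YV (scaleV (of_int a) u) k v + YV u k (scaleV (of_int b) v)"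
    using YV_d_bracket[of u k v]
    by (simp add: V.grading_op_homogeneous[OF u] V.grading_op_homogeneous[OF v] algebra_simps)
  also have "\<dots> = scaleV (of_int (a + b - k - 1)) (YV u k v)"
    by (simp add: module_hom.scale[OF linear_imp_module_hom[OF YV_linear_left]]
        module_hom.scale[OF linear_imp_module_hom[OF YV_linear_right]]
        flip: V.scale_left_distrib)
  finally have "complex_of_int i = of_int (a + b - k - 1)"
    using i by (rule V.grading_op_eigenvector)
  then show ?thesis by (simp only: of_int_eq_iff)
qed

lemma YV_degree:
  assumes "hom_comp grV (YV u k v) i \<noteq> 0"
  obtains a b where "hom_comp grV u a \<noteq> 0" "hom_comp grV v b \<noteq> 0" "i = a + b - k - 1"
proof -
  have "YV u k v = (\<Sum>a | hom_comp grV u a \<noteq> 0. YV (hom_comp grV u a) k v)"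
    using module_hom.sum[OF linear_imp_module_hom[OF YV_linear_left[where k = k and v = v]]]
    by (metis V.sum_hom_comp)
  also have "\<dots> = (\<Sum>a | hom_comp grV u a \<noteq> 0. \<Sum>b | hom_comp grV v b \<noteq> 0.
      YV (hom_comp grV u a) k (hom_comp grV v b))"
    using module_hom.sum[OF linear_imp_module_hom[OF YV_linear_right[where k = k]]]
    by (metis V.sum_hom_comp)
  finally have "(\<Sum>a | hom_comp grV u a \<noteq> 0. \<Sum>b | hom_comp grV v b \<noteq> 0.
      hom_comp grV (YV (hom_comp grV u a) k (hom_comp grV v b)) i) \<noteq> 0"
    using assms by (simp add: V.hom_comp_sum)
  then obtain a where a: "hom_comp grV u a \<noteq> 0"
    and "(\<Sum>b | hom_comp grV v b \<noteq> 0. hom_comp grV (YV (hom_comp grV u a) k (hom_comp grV v b)) i) \<noteq> 0"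
    by (auto elim: sum.not_neutral_contains_not_neutral)
  then obtain b where b: "hom_comp grV v b \<noteq> 0"
    and "hom_comp grV (YV (hom_comp grV u a) k (hom_comp grV v b)) i \<noteq> 0"
    by (auto elim: sum.not_neutral_contains_not_neutral)
  then have "i = a + b - k - 1" by (intro YV_degree_homogeneous[OF V.hom_comp_in V.hom_comp_in])
  with a b show ?thesis using that by blast
qed

text \<open>For large \<open>k\<close> every degree a + b - k - 1 that could occur lies below the
  lower bound of the grading. This bounds the powers of z1 - z2 in the iterate from below.\<close>

lemma YV_truncation: "\<exists>M. \<forall>k\<ge>M. YV u k v = 0"
proof -
  obtain L where L: "\<And>n. n < L \<Longrightarrow> grV n = {0}" using grV_lower_bound by blast
  let ?A = "{a. hom_comp grV u a \<noteq> 0}" and ?B = "{b. hom_comp grV v b \<noteq> 0}"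
  obtain A where A: "\<And>a. a \<in> ?A \<Longrightarrow> a \<le> A"
    using bdd_above_finite[OF V.finite_hom_comp_support[of u]] by (auto simp: bdd_above_def)
  obtain B where B: "\<And>b. b \<in> ?B \<Longrightarrow> b \<le> B"
    using bdd_above_finite[OF V.finite_hom_comp_support[of v]] by (auto simp: bdd_above_def)
  have "YV u k v = 0" if k: "k \<ge> A + B - L" for k
  proof -
    have "hom_comp grV (YV u k v) i = 0" for i
    proof (rule ccontr)
      assume nz: "hom_comp grV (YV u k v) i \<noteq> 0"
      then obtain a b where "hom_comp grV u a \<noteq> 0" "hom_comp grV v b \<noteq> 0" "i = a + b - k - 1"
        by (rule YV_degree)
      then have "i < L" using A[of a] B[of b] k by simp
      then show False using L nz V.hom_comp_in[of "YV u k v" i] by auto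
    qed
    then show ?thesis using V.sum_hom_comp[of "YV u k v"] by simp
  qed
  then show ?thesis by blast
qed

end

context mosva_bimodule
begin

text \<open>The eigenvector argument applies to the homogeneous components of \<open>u\<close>, one
  of which must contribute in degree \<open>i\<close>.\<close>

lemma YL_degree:
  assumes w: "w \<in> grW j" and i: "hom_comp grW (YL u k w) i \<noteq> 0"
  obtains a where "hom_comp grV u a \<noteq> 0" "i = j + of_int a - of_int k - 1"
proof -
  have "YL u k w = (\<Sum>a | hom_comp grV u a \<noteq> 0. YL (hom_comp grV u a) k w)"
    using module_hom.sum[OF linear_imp_module_hom[OF YL_linear_left[where k = k and w = w]]]
    by (metis V.sum_hom_comp)
  then have "(\<Sum>a | hom_comp grV u a \<noteq> 0. hom_comp grW (YL (hom_comp grV u a) k w) i) \<noteq> 0"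
    using i by (simp add: W.hom_comp_sum)
  then obtain a where a: "hom_comp grV u a \<noteq> 0"
    and nz: "hom_comp grW (YL (hom_comp grV u a) k w) i \<noteq> 0"
    by (auto elim: sum.not_neutral_contains_not_neutral)
  let ?u = "hom_comp grV u a"
  have "grading_op scaleW (\<lambda>m. m) grW (YL ?u k w) =
      YL (scaleV (of_int a) ?u) k w + scaleW (of_int (- k - 1)) (YL ?u k w) + YL ?u k (scaleW j w)"
    using YL_d_bracket[of ?u k w]
    by (simp add: V.grading_op_homogeneous[OF V.hom_comp_in] W.grading_op_homogeneous[OF w] algebra_simps)
  also have "\<dots> = scaleW (of_int a + of_int (- k - 1) + j) (YL ?u k w)"
    by (simp only: module_hom.scale[OF linear_imp_module_hom[OF YL_linear_left]]
        module_hom.scale[OF linear_imp_module_hom[OF YL_linear_right]] W.scale_left_distrib)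
  also have "of_int a + of_int (- k - 1) + j = j + of_int a - of_int k - 1" by simp
  finally have "i = j + of_int a - of_int k - 1"
    using nz by (rule W.grading_op_eigenvector)
  with a show ?thesis using that by blast
qed

text \<open>The relation of \<open>YL_degree\<close> solved for the source degree \<open>j\<close>;
  finite because \<open>u\<close> has finitely many components.\<close>

definition YL_source :: "'v \<Rightarrow> int \<Rightarrow> complex \<Rightarrow> complex set" where
  "YL_source u k i = (\<lambda>a. i - of_int a + of_int k + 1) ` {a. hom_comp grV u a \<noteq> 0}"

lemma degree_finite_YL: "W.degree_finite_op (YL u k) (YL_source u k)"
  unfolding W.degree_finite_op_def
proof (intro conjI allI ballI impI)
  fix i j w assume w: "w \<in> grW j" "hom_comp grW (YL u k w) i \<noteq> 0"
  then obtain a where "hom_comp grV u a \<noteq> 0" "i = j + of_int a - of_int k - 1"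
    by (rule YL_degree)
  then show "j \<in> YL_source u k i" by (auto simp: YL_source_def image_iff)
qed (auto simp: YL_source_def YL_linear_right V.finite_hom_comp_support)

text \<open>The degrees of \<open>W\<close> seen by \<open>\<phi>\<close> through \<open>Y\<^sub>k\<^sub>1(u\<^sub>1) Y\<^sub>k\<^sub>2(u\<^sub>2)\<close>, or through
  \<open>Y\<^sub>k\<^sub>2(Y\<^sub>k\<^sub>1(u\<^sub>1)u\<^sub>2)\<close>, when \<open>k\<^sub>1 + k\<^sub>2 + 2 = N\<close>.\<close>

definition degree_window :: "('w \<Rightarrow> complex) \<Rightarrow> 'v \<Rightarrow> 'v \<Rightarrow> int \<Rightarrow> complex set" where
  "degree_window \<phi> u1 u2 N = (\<lambda>(i, a, b). i - of_int (a + b) + of_int N) `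
     (dual_support grW \<phi> \<times> {a. hom_comp grV u1 a \<noteq> 0} \<times> {b. hom_comp grV u2 b \<noteq> 0})"

section \<open>Modes of fixed total degree seen by one functional\<close>

context
  fixes \<phi> assumes \<phi>: "\<phi> \<in> graded_dual scaleW grW"
begin

lemma finite_degree_window: "finite (degree_window \<phi> u1 u2 N)"
  by (simp add: degree_window_def W.finite_dual_support[OF \<phi>] V.finite_hom_comp_support)

text \<open>The window for N is the window for 0 shifted by N. It is finite, so its real parts are
  at most B + N, which is below the lower bound \<open>r\<close> of the grading once N is small
  enough.\<close>

lemma degree_window_trivial: "\<exists>N0. \<forall>N<N0. \<forall>j\<in>degree_window \<phi> u1 u2 N. grW j = {0}"
proof -
  obtain r where r: "\<And>m. Re m < r \<Longrightarrow> grW m = {0}" using grW_lower_bound by blast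
  let ?A = "degree_window \<phi> u1 u2 0"
  obtain B where B: "\<And>x. x \<in> ?A \<Longrightarrow> Re x \<le> B"
    using bdd_above_finite[OF finite_imageI[OF finite_degree_window[of u1 u2 0], of Re]]
    unfolding bdd_above_def by blast
  have "grW j = {0}" if N: "N < \<lfloor>r - B\<rfloor>" and j: "j \<in> degree_window \<phi> u1 u2 N" for N j
  proof (rule r)
    have "j - of_int N \<in> ?A" using j by (force simp: degree_window_def)
    from B[OF this] show "Re j < r" using N by (simp; linarith)
  qed
  then show ?thesis by blast
qed

text \<open>A mode of index k changes the degree by a - k - 1, so for two modes the indices enter
  only through k1 + k2 + 2.\<close>

lemma product_functional:
  assumes N: "k1 + k2 + 2 = N"
  shows "\<phi> \<circ> YL u1 k1 \<circ> YL u2 k2 \<in> graded_dual scaleW grW"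
    and "dual_support grW (\<phi> \<circ> YL u1 k1 \<circ> YL u2 k2) \<subseteq> degree_window \<phi> u1 u2 N"
proof -
  note 1 = W.dual_comp_op[OF \<phi> degree_finite_YL[of u1 k1]]
  note 2 = W.dual_comp_op[OF 1(1) degree_finite_YL[of u2 k2]]
  show "\<phi> \<circ> YL u1 k1 \<circ> YL u2 k2 \<in> graded_dual scaleW grW" by (rule 2(1))
  show "dual_support grW (\<phi> \<circ> YL u1 k1 \<circ> YL u2 k2) \<subseteq> degree_window \<phi> u1 u2 N"
  proof
    fix j assume "j \<in> dual_support grW (\<phi> \<circ> YL u1 k1 \<circ> YL u2 k2)"
    then obtain i a b where "i \<in> dual_support grW \<phi>" "hom_comp grV u1 a \<noteq> 0" "hom_comp grV u2 b \<noteq> 0"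
      "j = i - of_int a + of_int k1 + 1 - of_int b + of_int k2 + 1"
      using 1(2) 2(2) unfolding YL_source_def by blast
    moreover from this have "j = i - of_int (a + b) + of_int N" by (simp flip: N)
    ultimately show "j \<in> degree_window \<phi> u1 u2 N"
      unfolding degree_window_def by (intro image_eqI[where x = "(i, a, b)"]) simp_all
  qed
qed

text \<open>The degrees a + b - k1 - 1 of the inner vector absorb k1, so the window is the same as
  for the product. Hence one vector of \<open>W\<close> can serve both series.\<close>

lemma iterate_functional:
  assumes N: "k1 + k2 + 2 = N"
  shows "\<phi> \<circ> YL (YV u1 k1 u2) k2 \<in> graded_dual scaleW grW"
    and "dual_support grW (\<phi> \<circ> YL (YV u1 k1 u2) k2) \<subseteq> degree_window \<phi> u1 u2 N"
proof -
  note 1 = W.dual_comp_op[OF \<phi> degree_finite_YL[of "YV u1 k1 u2" k2]]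
  show "\<phi> \<circ> YL (YV u1 k1 u2) k2 \<in> graded_dual scaleW grW" by (rule 1(1))
  show "dual_support grW (\<phi> \<circ> YL (YV u1 k1 u2) k2) \<subseteq> degree_window \<phi> u1 u2 N"
  proof
    fix j assume "j \<in> dual_support grW (\<phi> \<circ> YL (YV u1 k1 u2) k2)"
    then obtain i c where i: "i \<in> dual_support grW \<phi>" and c: "hom_comp grV (YV u1 k1 u2) c \<noteq> 0"
      and j: "j = i - of_int c + of_int k2 + 1"
      using 1(2) unfolding YL_source_def by blast
    from c obtain a b where ab: "hom_comp grV u1 a \<noteq> 0" "hom_comp grV u2 b \<noteq> 0" "c = a + b - k1 - 1"
      by (rule YV_degree)
    have "j = i - of_int (a + b) + of_int N" by (simp add: j ab(3) flip: N)
    with i ab(1,2) show "j \<in> degree_window \<phi> u1 u2 N"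
      unfolding degree_window_def by (intro image_eqI[where x = "(i, a, b)"]) simp_all
  qed
qed

text \<open>Total degrees are separated by letting \<open>s\<close> vary in \<open>z\<^sub>1 = (1 + t) / s\<close>, \<open>z\<^sub>2 = 1 / s\<close>.\<close>

lemma associativity_by_degree:
  fixes t :: real and u1 u2 :: 'v and w :: 'w and N :: int
  assumes t: "0 < t" "t < 1"
  defines "c \<equiv> \<lambda>k N. \<phi> (YL u1 k (YL u2 (N - 2 - k) w)) * of_real (1 + t) powi (- k - 1)"
    and "d \<equiv> \<lambda>k N. \<phi> (YL (YV u1 k u2) (N - 2 - k) w) * of_real t powi (- k - 1)"
  shows "(\<lambda>k. norm (d k N)) summable_on UNIV" "(\<Sum>\<^sub>\<infinity>k. c k N) = (\<Sum>\<^sub>\<infinity>k. d k N)"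
proof -
  \<comment> \<open>For 0 < t < 1 the point satisfies |z1| > |z2| > |z1 - z2| > 0 for every positive
    \<open>s\<close>, so the module axioms apply and both series have one sum; they are then
    reindexed by (k1, k1 + k2 + 2).\<close>
  have both: "\<exists>G. abs_has_sum (\<lambda>(k, N). c k N * of_real s powi N) UNIV G \<and>
      abs_has_sum (\<lambda>(k, N). d k N * of_real s powi N) UNIV G" if s: "0 < s" for s :: real
  proof -
    define z1 z2 where "z1 = complex_of_real ((1 + t) / s)" and "z2 = complex_of_real (1 / s)"
    have nz: "norm z1 = (1 + t) / s" "norm z2 = 1 / s" "norm (z1 - z2) = t / s"
      using s t by (simp_all add: z1_def z2_def norm_divide diff_divide_distrib[symmetric]
          flip: of_real_diff of_real_add of_real_divide)
    have ord: "norm z1 > norm z2" "norm z2 > norm (z1 - z2)" "norm (z1 - z2) > 0"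
      unfolding nz using s t by (simp_all add: divide_strict_right_mono)
    have rad: "radially_ordered [z1, z2]"
      using ord by (auto simp: radially_ordered_def)
    let ?c = "\<lambda>ks. \<phi> (mode_product YL [u1, u2] ks w)" and ?d = "\<lambda>k1 k2. \<phi> (YL (YV u1 k1 u2) k2 w)"
    obtain R where R: "abs_has_sum (product_term ?c [z1, z2]) {ks. length ks = 2} (R [z1, z2])"
    proof -
      obtain R where "product_converges_to 2 ?c R"
        using YL_product_rational[OF \<phi>, of "[u1, u2]" w]
        by (auto simp: product_rational_def numeral_2_eq_2)
      then show ?thesis using rad that[of R] by (simp add: product_converges_to_def)
    qed
    obtain R' where R': "abs_has_sum (iterate_term ?d z1 z2) UNIV (R' [z1, z2])"
      using YL_iterate_rational[OF \<phi>, of u1 u2 w] ord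
      by (auto simp: iterate_rational_def iterate_converges_to_def)
    have G: "R [z1, z2] = R' [z1, z2]"
      using YL_associativity[OF \<phi>, of u1 u2 w] ord R R' infsumI
      unfolding product_iterate_agree_def abs_has_sum_def by metis
    have bij1: "bij_betw (\<lambda>(k, N). [k, N - 2 - k]) UNIV {ks :: int list. length ks = 2}"
      by (rule bij_betwI[where g = "\<lambda>ks. (ks ! 0, ks ! 0 + ks ! 1 + 2)"])
        (auto simp: length_Suc_conv numeral_2_eq_2)
    have term1: "product_term ?c [z1, z2] ((\<lambda>(k, N). [k, N - 2 - k]) l) =
        (\<lambda>(k, N). c k N * of_real s powi N) l" for l
    proof -
      obtain k N where l: "l = (k, N)" by (cases l)
      have "z1 powi (- k - 1) * z2 powi (- (N - 2 - k) - 1) = of_real (1 + t) powi (- k - 1) * of_real s powi N"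
        using power_int_scale[of "of_real s" "of_real (1 + t)" k N] s by (simp add: z1_def z2_def)
      then show ?thesis
        by (simp add: l c_def product_term_def mode_product_def lessThan_Suc mult_ac)
    qed
    have bij2: "bij (\<lambda>(k, N). (k, N - 2 - k :: int))"
      by (rule o_bij[where g = "\<lambda>(k1, k2). (k1, k1 + k2 + 2)"]) (auto simp: fun_eq_iff)
    have term2: "iterate_term ?d z1 z2 ((\<lambda>(k, N). (k, N - 2 - k)) l) =
        (\<lambda>(k, N). d k N * of_real s powi N) l" for l
    proof -
      obtain k N where l: "l = (k, N)" by (cases l)
      have "z1 - z2 = of_real t / of_real s" by (simp add: z1_def z2_def add_divide_distrib)
      then have "(z1 - z2) powi (- k - 1) * z2 powi (- (N - 2 - k) - 1) = of_real t powi (- k - 1) * of_real s powi N"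
        using power_int_scale[of "of_real s" "of_real t" k N] s by (simp add: z2_def)
      then show ?thesis by (simp add: l d_def iterate_term_def mult_ac)
    qed
    show ?thesis
      using abs_has_sum_reindex[OF bij1, THEN iffD2, OF R]
        abs_has_sum_reindex[OF bij2, THEN iffD2, OF R'] unfolding term1 term2 G by blast
  qed
  \<comment> \<open>For very negative N the window meets only trivial degrees, so the functionals
    have empty support. This is the lower bound on the powers of \<open>s\<close>.\<close>
  have vanish: "\<exists>N0. \<forall>N<N0. \<forall>k. c k N = 0 \<and> d k N = 0"
  proof -
    obtain N0 where N0: "\<And>N j. N < N0 \<Longrightarrow> j \<in> degree_window \<phi> u1 u2 N \<Longrightarrow> grW j = {0}"
      using degree_window_trivial by blast
    have "\<psi> w = 0" if "\<psi> \<in> graded_dual scaleW grW" "dual_support grW \<psi> \<subseteq> degree_window \<phi> u1 u2 N" "N < N0"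
      for \<psi> N
    proof -
      have "dual_support grW \<psi> = {}"
        using that(2) N0[OF that(3)] module_hom.zero[OF linear_imp_module_hom[OF W.graded_dual_linear[OF that(1)]]]
        by (fastforce simp: dual_support_def)
      then show ?thesis
        using W.pairing_eq_sum[OF W.hom_comp_in_completion, of "{}" \<psi> w] W.pairing_hom_comp[OF that(1)] by simp
    qed
    from this[OF product_functional(1,2)] this[OF iterate_functional(1,2)]
    have "c k N = 0 \<and> d k N = 0" if "N < N0" for k N
      using that unfolding c_def d_def by simp
    then show ?thesis by blast
  qed
  then obtain N0 where N0: "\<And>k N. N < N0 \<Longrightarrow> c k N = 0" "\<And>k N. N < N0 \<Longrightarrow> d k N = 0" by blast
  show "(\<lambda>k. norm (d k N)) summable_on UNIV"
    using both[of 1] abs_has_sum_by_rows(1)[of d 1] by auto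
  show "(\<Sum>\<^sub>\<infinity>k. c k N) = (\<Sum>\<^sub>\<infinity>k. d k N)"
  proof (rule laurent_coeff_unique[where e = 1 and m = N0 and m' = N0])
    fix s :: real assume s: "0 < s" "s < 1"
    then obtain G where "abs_has_sum (\<lambda>(k, N). c k N * of_real s powi N) UNIV G"
      "abs_has_sum (\<lambda>(k, N). d k N * of_real s powi N) UNIV G" using both by blast
    from this[THEN abs_has_sum_by_rows(2)]
    show "\<exists>G. ((\<lambda>N. (\<Sum>\<^sub>\<infinity>k. c k N) * of_real s powi N) has_sum G) UNIV \<and>
        ((\<lambda>N. (\<Sum>\<^sub>\<infinity>k. d k N) * of_real s powi N) has_sum G) UNIV"
      using s by auto
  qed (simp_all add: N0)
qed


section \<open>Identification of the coefficients of the iterate series\<close>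

text \<open>Comparing powers of \<open>s\<close> at fixed \<open>t\<close> equates the part of the
  product of total degree N with that of the expansion of \<open>H\<close>. Associativity rewrites
  this part as an iterate, after which powers of \<open>t\<close> are compared. Real
  \<open>t\<close> in (0, 1) and small \<open>s\<close> are enough.\<close>

lemma iterate_coefficients:
  assumes x: "x \<in> completion grW" and e: "laurent_coeffs Z H e m"
    and conv: "\<And>t::real. 0 < t \<Longrightarrow> t < 1 \<Longrightarrow> \<exists>\<epsilon>>0. \<forall>s. 0 < s \<longrightarrow> s < \<epsilon> \<longrightarrow>
      (of_real t, of_real s) \<in> laurent_region Z \<and>
      abs_has_sum (\<lambda>(k1, k2).
          pairing \<phi> (completion_op grW (YL u1 k1) (completion_op grW (YL u2 k2) x)) *
          ((1 + of_real t) / of_real s) powi (- k1 - 1) * (1 / of_real s) powi (- k2 - 1))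
        UNIV (H (of_real t) (of_real s))"
  shows "pairing \<phi> (completion_op grW (YL (YV u1 k1 u2) k2) x) = e (- k1 - 1, k1 + k2 + 2)"
proof -
  define N where "N = k1 + k2 + 2"
  \<comment> \<open>The components of \<open>x\<close> in the window form a genuine vector of
    \<open>W\<close>, to which the module axioms apply, whereas \<open>x\<close> itself lies only in
    the completion.\<close>
  define w where "w N = (\<Sum>j\<in>degree_window \<phi> u1 u2 N. x j)" for N
  have fun_w: "pairing \<psi> x = \<psi> (w N)"
    if "\<psi> \<in> graded_dual scaleW grW" "dual_support grW \<psi> \<subseteq> degree_window \<phi> u1 u2 N" for \<psi> N
    unfolding w_def W.pairing_eq_sum[OF x finite_degree_window that(2)]
    by (rule module_hom.sum[OF linear_imp_module_hom[OF W.graded_dual_linear[OF that(1)]], symmetric])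
  have prod_w: "pairing \<phi> (completion_op grW (YL u1 k1) (completion_op grW (YL u2 k2) x)) =
      \<phi> (YL u1 k1 (YL u2 k2 (w N)))" if N: "k1 + k2 + 2 = N" for k1 k2 N
    using W.pairing_completion_op[OF \<phi> degree_finite_YL[of u1 k1] W.completion_op_in_completion]
      W.pairing_completion_op[OF W.dual_comp_op(1)[OF \<phi> degree_finite_YL[of u1 k1]] degree_finite_YL[of u2 k2] x]
      fun_w[OF product_functional[OF N]] by simp
  have iter_w: "pairing \<phi> (completion_op grW (YL (YV u1 k1 u2) k2) x) = \<phi> (YL (YV u1 k1 u2) k2 (w N))"
    if N: "k1 + k2 + 2 = N" for k1 k2 N
    using W.pairing_completion_op[OF \<phi> degree_finite_YL[of "YV u1 k1 u2" k2] x]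
      fun_w[OF iterate_functional[OF N]] by simp
  obtain N0 where N0: "\<And>N j. N < N0 \<Longrightarrow> j \<in> degree_window \<phi> u1 u2 N \<Longrightarrow> grW j = {0}"
    using degree_window_trivial by blast
  have w0: "w N = 0" if "N < N0" for N
    unfolding w_def using N0[OF that] x by (force simp: completion_def intro: sum.neutral)
  have zero: "YL u k 0 = 0" "\<phi> 0 = 0" "YL 0 k v = 0" for u k v
    using module_hom.zero[OF linear_imp_module_hom[OF YL_linear_right]]
      module_hom.zero[OF linear_imp_module_hom[OF W.graded_dual_linear[OF \<phi>]]]
      module_hom.zero[OF linear_imp_module_hom[OF YL_linear_left]] by blast+
  obtain M where M: "\<And>k. k \<ge> M \<Longrightarrow> YV u1 k u2 = 0" using YV_truncation by blast
  \<comment> \<open>\<open>E t N\<close> is the coefficient of \<open>s powi N\<close> in the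
    expansion of \<open>H\<close>, and \<open>C t N\<close> is that of the product series.\<close>
  define E where "E t N = (\<Sum>\<^sub>\<infinity>k. e (k, N) * of_real t powi k)" for t :: real and N
  define C where "C t N = (\<Sum>\<^sub>\<infinity>k. \<phi> (YL u1 k (YL u2 (N - 2 - k) (w N))) * of_real (1 + t) powi (- k - 1))"
    for t :: real and N
  have E_sum: "abs_has_sum (\<lambda>(k, N). (e (k, N) * t powi k) * s powi N) UNIV (H t s)"
    if "(t, s) \<in> laurent_region Z" for t s
    using e that unfolding laurent_coeffs_def by (auto simp: case_prod_unfold mult.assoc)
  have CE: "C t N = E t N" and E_row: "((\<lambda>k. e (k, N) * of_real t powi k) has_sum E t N) UNIV"
    if t: "0 < t" "t < 1" for t :: real and N
  proof -
    obtain \<epsilon> where \<epsilon>: "\<epsilon> > 0" and reg: "\<And>s. 0 < s \<Longrightarrow> s < \<epsilon> \<Longrightarrow> (of_real t, of_real s) \<in> laurent_region Z"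
      and hyp: "\<And>s. 0 < s \<Longrightarrow> s < \<epsilon> \<Longrightarrow> abs_has_sum (\<lambda>(k1, k2).
          pairing \<phi> (completion_op grW (YL u1 k1) (completion_op grW (YL u2 k2) x)) *
          ((1 + of_real t) / of_real s) powi (- k1 - 1) * (1 / of_real s) powi (- k2 - 1))
        UNIV (H (of_real t) (of_real s))"
      using conv[OF t] by blast
    have "(of_real t, of_real (\<epsilon> / 2)) \<in> laurent_region Z" using \<epsilon> by (intro reg) simp_all
    then have "(\<lambda>k. norm (e (k, N) * of_real t powi k)) summable_on UNIV"
      by (rule abs_has_sum_by_rows(1)[OF E_sum]) (use \<epsilon> in simp)
    then show "((\<lambda>k. e (k, N) * of_real t powi k) has_sum E t N) UNIV"
      unfolding E_def by (rule has_sum_infsum[OF abs_summable_summable])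
    show "C t N = E t N"
    proof (rule laurent_coeff_unique[where a = "C t" and b = "E t", OF _ _ \<epsilon>])
      show "C t N = 0" if "N < N0" for N by (simp add: C_def w0[OF that] zero)
      show "E t N = 0" if "N < m" for N
      proof -
        have "e (k, N) = 0" for k using e that by (force simp: laurent_coeffs_def)
        then show ?thesis by (simp add: E_def)
      qed
      fix s assume s: "0 < s" "s < \<epsilon>"
      let ?s = "complex_of_real s"
      have s0: "?s \<noteq> 0" using s by simp
      have bij: "bij (\<lambda>(k, N). (k, N - 2 - k :: int))"
        by (rule o_bij[where g = "\<lambda>(k1, k2). (k1, k1 + k2 + 2)"]) (auto simp: fun_eq_iff)
      have "abs_has_sum (\<lambda>(k, N). \<phi> (YL u1 k (YL u2 (N - 2 - k) (w N))) *
          of_real (1 + t) powi (- k - 1) * ?s powi N) UNIV (H (of_real t) ?s)"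
        using abs_has_sum_reindex[OF bij, THEN iffD2, OF hyp[OF s]] power_int_scale[OF s0, of "of_real (1 + t)"]
        by (simp add: case_prod_unfold prod_w mult.assoc)
      then have "((\<lambda>N. C t N * ?s powi N) has_sum H (of_real t) ?s) UNIV"
        unfolding C_def using s0 by (rule abs_has_sum_by_rows(2))
      moreover have "((\<lambda>N. E t N * ?s powi N) has_sum H (of_real t) ?s) UNIV"
        unfolding E_def using abs_has_sum_by_rows(2)[OF E_sum[OF reg[OF s]] s0] .
      ultimately show "\<exists>G. ((\<lambda>N. C t N * ?s powi N) has_sum G) UNIV \<and>
          ((\<lambda>N. E t N * ?s powi N) has_sum G) UNIV" by blast
    qed
  qed
  \<comment> \<open>Associativity turns \<open>C t N\<close> into the iterate sum; the substitution
    of - k - 1 for k then makes k the exponent of \<open>t\<close>, and N - 2 - k becomes N - 1 +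
    k.\<close>
  have D_row: "((\<lambda>k. \<phi> (YL (YV u1 (- k - 1) u2) (N - 1 + k) (w N)) * of_real t powi k) has_sum C t N) UNIV"
    if t: "0 < t" "t < 1" for t :: real
  proof -
    note assoc = associativity_by_degree[OF t, of u1 u2 N "w N"]
    have "((\<lambda>k. \<phi> (YL (YV u1 k u2) (N - 2 - k) (w N)) * of_real t powi (- k - 1)) has_sum C t N) UNIV"
      unfolding C_def assoc(2) by (rule has_sum_infsum[OF abs_summable_summable[OF assoc(1)]])
    moreover have "bij (\<lambda>k :: int. - k - 1)"
      by (rule o_bij[where g = "\<lambda>k. - k - 1"]) (auto simp: fun_eq_iff)
    ultimately show ?thesis
      using has_sum_reindex_bij_betw[of "\<lambda>k. - k - 1" UNIV UNIV
        "\<lambda>k. \<phi> (YL (YV u1 k u2) (N - 2 - k) (w N)) * of_real t powi (- k - 1)" "C t N"]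
      by (simp add: algebra_simps)
  qed
  have "\<phi> (YL (YV u1 (- k - 1) u2) (N - 1 + k) (w N)) = e (k, N)" for k
  proof (rule laurent_coeff_unique[where e = 1 and b = "\<lambda>k. e (k, N)" and
        a = "\<lambda>k. \<phi> (YL (YV u1 (- k - 1) u2) (N - 1 + k) (w N))"])
    \<comment> \<open>For k < - M the inner mode index - k - 1 is at least M, where truncation
      applies.\<close>
    show "\<phi> (YL (YV u1 (- k - 1) u2) (N - 1 + k) (w N)) = 0" if "k < - M" for k
      using M[of "- k - 1"] that by (simp add: zero)
    show "e (k, N) = 0" if "k < m" for k using e that by (force simp: laurent_coeffs_def)
    fix t :: real assume t: "0 < t" "t < 1"
    show "\<exists>G. ((\<lambda>k. \<phi> (YL (YV u1 (- k - 1) u2) (N - 1 + k) (w N)) * of_real t powi k) has_sum G) UNIV \<and>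
        ((\<lambda>k. e (k, N) * of_real t powi k) has_sum G) UNIV"
      using D_row[OF t] E_row[OF t, of N] unfolding CE[OF t, of N] by blast
  qed simp
  from this[of "- k1 - 1"] show ?thesis
    using iter_w[OF N_def[symmetric]] by (simp add: N_def)
qed

end

end

section \<open>Associativity on the completion\<close>

lemma iterate_region_subset: "iterate_region n \<subseteq> product_region n"
  by (force simp: iterate_region_def product_region_def intro: le_less_trans[rotated])

text \<open>Two extensions agree on \<open>iterate_region n\<close> by uniqueness of sums, hence
  everywhere by the identity theorem. Allowing a larger \<open>S\<close> covers the product region
  as well.\<close>

lemma (in graded_vector_space) rational_extension_eqI:
  assumes g: "sum_extends_to scl gr (n + 2) S t g" and S: "iterate_region n \<subseteq> S"
  shows "rational_extension scl gr (n + 2) S t = g"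
  unfolding rational_extension_def
proof (rule the_equality)
  show "sum_extends_to scl gr (n + 2) S t g" by (rule g)
next
  fix h assume h: "sum_extends_to scl gr (n + 2) S t h"
  obtain as where as: "as \<in> iterate_region n" using iterate_region_nonempty by blast
  show "h = g"
  proof (rule rational_maps_eqI)
    show "h \<in> rational_maps scl gr (n + 2)" "g \<in> rational_maps scl gr (n + 2)"
      using g h by (simp_all add: sum_extends_to_def)
    show "length as = n + 2" "iterate_region n \<subseteq> config (n + 2)"
      using as by (auto simp: iterate_region_def config_def)
    show "\<forall>\<^sub>F t::real in at_right 0. map2 (\<lambda>a b. a + of_real t * (b - a)) as bs \<in> iterate_region n"
      if "length bs = n + 2" for bs
      using as that by (rule line_into_iterate_region)
    show "pairing \<phi> (h zs) = pairing \<phi> (g zs)"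
      if "\<phi> \<in> graded_dual scl gr" "zs \<in> iterate_region n" for \<phi> zs
      using g h that S has_sum_unique
      unfolding sum_extends_to_def completion_has_sum_def abs_has_sum_def by blast
  qed
qed

text \<open>As \<open>s\<close> tends to 0, z1 and z2 go to infinity with fixed ratio 1 + t while
  \<open>xs\<close> stays put. This supplies the small \<open>s\<close> required by
  \<open>iterate_coefficients\<close>.\<close>

lemma product_region_scaled:
  assumes t: "0 < t" "t < 1" and xs: "xs \<in> config n"
  shows "\<exists>\<epsilon>>0. \<forall>s::real. 0 < s \<longrightarrow> s < \<epsilon> \<longrightarrow>
    (of_real t, of_real s) \<in> laurent_region (set xs) \<and>
    (1 + of_real t) / of_real s # 1 / of_real s # xs \<in> product_region n"
proof -
  \<comment> \<open>The summand 1 makes \<open>B\<close> positive and a strict bound for the norms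
    of \<open>xs\<close>.\<close>
  define B where "B = 1 + (\<Sum>z\<in>set xs. norm z)"
  have B: "norm z < B" if "z \<in> set xs" for z
    using member_le_sum[OF that, of norm] by (simp add: B_def)
  have B0: "B > 0" by (simp add: B_def add_pos_nonneg sum_nonneg)
  show ?thesis
  \<comment> \<open>This bound on \<open>s\<close> yields |z| s < 1 - t, which gives both t + |z s|
    < 1 and |z| < 1 / s.\<close>
  proof (intro exI[of _ "(1 - t) / B"] conjI allI impI)
    show "(1 - t) / B > 0" using t B0 by simp
    fix s :: real assume s: "0 < s" "s < (1 - t) / B"
    have sB: "s * B < 1 - t" using s B0 by (simp add: field_simps)
    have zs: "norm (z * of_real s) < 1 - t" if "z \<in> set xs" for z
    proof -
      have "norm z * s < B * s" using B[OF that] s by simp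
      then have "norm z * s < 1 - t" using sB by (simp add: mult.commute)
      then show ?thesis using s by (simp add: norm_mult)
    qed
    show "(of_real t, of_real s) \<in> laurent_region (set xs)"
      using t s zs[THEN add_strict_left_mono, of _ t] by (simp add: laurent_region_def)
    let ?z1 = "(1 + complex_of_real t) / of_real s" and ?z2 = "1 / complex_of_real s"
    have "?z1 = of_real ((1 + t) / s)" "?z2 = of_real (1 / s)" by simp_all
    then have n1: "norm ?z1 = (1 + t) / s" and n2: "norm ?z2 = 1 / s"
      using t s by (simp_all only: norm_of_real) simp_all
    have lt: "norm ?z2 < norm ?z1" unfolding n1 n2 using t s by (simp add: divide_strict_right_mono)
    have z: "norm z < norm ?z2" if "z \<in> set xs" for z
      unfolding n2 using zs[OF that] t s by (simp add: norm_mult field_simps)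
    have "distinct (?z1 # ?z2 # xs)"
      using xs lt z less_asym by (auto simp: config_def)
    moreover have "norm ((?z1 # ?z2 # xs) ! i) < norm ?z2" if "i \<in> {2..<n + 2}" for i
    proof -
      have "xs ! (i - 2) \<in> set xs" using that xs by (intro nth_mem) (auto simp: config_def)
      from z[OF this] show ?thesis using that by (simp add: nth_Cons' numeral_2_eq_2)
    qed
    ultimately show "?z1 # ?z2 # xs \<in> product_region n"
      using lt xs by (simp add: product_region_def config_def)
  qed
qed

text \<open>The coefficients are identified using real \<open>t\<close> and small \<open>s\<close>
  only. At a general point of the region, absolute convergence and the value of the sum come from
  the Laurent expansion of the rational function paired from \<open>g\<close>.\<close>

lemma (in mosva_bimodule) iterate_series_converges:
  assumes n: "n \<ge> 1" and f: "f \<in> rational_maps scaleW grW n"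
    and g: "sum_extends_to scaleW grW (n + 2) (product_region n)
      (YL_product_series scaleW grW YL u1 u2 f) g"
    and zs: "zs \<in> iterate_region n"
  shows "completion_has_sum scaleW grW (YL_iterate_series scaleW grW YV YL u1 u2 f zs) (g zs)"
  unfolding completion_has_sum_def
proof (intro conjI ballI)
  have zs_config: "zs \<in> config (n + 2)" using zs by (simp add: iterate_region_def)
  show "g zs \<in> completion grW" using g zs_config by (auto simp: sum_extends_to_def rational_maps_def)
  fix \<phi> assume \<phi>: "\<phi> \<in> graded_dual scaleW grW"
  have "\<exists>z1 z2 xs. zs = z1 # z2 # xs"
    using zs_config by (auto simp: config_def numeral_2_eq_2 length_Suc_conv)
  then obtain z1 z2 xs where zs_eq: "zs = z1 # z2 # xs" by blast
  have xs: "xs \<in> config n" using zs_config by (simp add: zs_eq config_def)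
  then have x: "f xs \<in> completion grW" using f by (auto simp: rational_maps_def)
  have z12: "z1 \<noteq> z2" using zs_config by (simp add: zs_eq config_def)
  have less: "norm (z1 - z2) + norm z < norm z2" if "z \<in> set xs" for z
  proof -
    obtain i where i: "i < n" "z = xs ! i" using xs \<open>z \<in> set xs\<close> by (auto simp: config_def in_set_conv_nth)
    have "i + 2 \<in> {2..<n + 2}" using i by simp
    then have "norm (zs ! 1) > norm (zs ! 0 - zs ! 1) + norm (zs ! (i + 2))"
      using zs unfolding iterate_region_def by blast
    then show ?thesis by (simp add: zs_eq i)
  qed
  \<comment> \<open>Since \<open>n \<ge> 1\<close> there is an entry z, and the defining inequality
    of the region gives |z1 - z2| < |z2|, so z2 is nonzero and t will satisfy |t| < 1.\<close>
  obtain z where "z \<in> set xs" using xs n by (cases xs) (auto simp: config_def)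
  from less[OF this] have less': "norm (z1 - z2) < norm z2" using norm_ge_zero[of z] by linarith
  then have z2: "z2 \<noteq> 0" by auto
  obtain p b where p: "polynomial_fun (n + 2) p" and
    gp: "\<And>zs. zs \<in> config (n + 2) \<Longrightarrow>
      pairing \<phi> (g zs) = p zs / difference_product (n + 2) (\<lambda>i j. int (b i j)) zs"
    using g \<phi> by (fastforce simp: sum_extends_to_def rational_maps_def)
  define H where "H t s = p ((1 + t) / s # 1 / s # xs) /
    difference_product (n + 2) (\<lambda>i j. int (b i j)) ((1 + t) / s # 1 / s # xs)" for t s
  have "laurent_expandable (set xs) H"
    unfolding H_def using p xs by (intro laurent_expandable_rational) (simp_all add: config_def)
  then obtain e m where e: "laurent_coeffs (set xs) H e m" by (auto simp: laurent_expandable_def)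
  have coeff: "pairing \<phi> (completion_op grW (YL (YV u1 k1 u2) k2) (f xs)) = e (- k1 - 1, k1 + k2 + 2)" for k1 k2
  proof (rule iterate_coefficients[OF \<phi> x e])
    fix t :: real assume t: "0 < t" "t < 1"
    obtain \<epsilon> where \<epsilon>: "\<epsilon> > 0" and reg: "\<And>s. 0 < s \<Longrightarrow> s < \<epsilon> \<Longrightarrow>
        (of_real t, of_real s) \<in> laurent_region (set xs) \<and>
        (1 + of_real t) / of_real s # 1 / of_real s # xs \<in> product_region n"
      using product_region_scaled[OF t xs] by blast
    have "abs_has_sum (\<lambda>(k1, k2).
          pairing \<phi> (completion_op grW (YL u1 k1) (completion_op grW (YL u2 k2) (f xs))) *
          ((1 + of_real t) / of_real s) powi (- k1 - 1) * (1 / of_real s) powi (- k2 - 1))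
        UNIV (H (of_real t) (of_real s))" if s: "0 < s" "s < \<epsilon>" for s :: real
    proof -
      let ?zs = "(1 + complex_of_real t) / of_real s # 1 / of_real s # xs"
      have r: "?zs \<in> product_region n" using reg[OF s] by blast
      then have "?zs \<in> config (n + 2)" by (simp add: product_region_def)
      from gp[OF this] have "pairing \<phi> (g ?zs) = H (of_real t) (of_real s)" by (simp add: H_def)
      moreover have "abs_has_sum (\<lambda>k. pairing \<phi> (YL_product_series scaleW grW YL u1 u2 f ?zs k)) UNIV
          (pairing \<phi> (g ?zs))"
        using g r \<phi> unfolding sum_extends_to_def completion_has_sum_def by blast
      ultimately show ?thesis
        by (simp add: YL_product_series_def case_prod_unfold W.pairing_scale[OF \<phi>] mult_ac)
    qed
    with \<epsilon> reg show "\<exists>\<epsilon>>0. \<forall>s. 0 < s \<longrightarrow> s < \<epsilon> \<longrightarrow> (of_real t, of_real s) \<in> laurent_region (set xs) \<and>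
      abs_has_sum (\<lambda>(k1, k2).
          pairing \<phi> (completion_op grW (YL u1 k1) (completion_op grW (YL u2 k2) (f xs))) *
          ((1 + of_real t) / of_real s) powi (- k1 - 1) * (1 / of_real s) powi (- k2 - 1))
        UNIV (H (of_real t) (of_real s))" by blast
  qed
  define t s where "t = (z1 - z2) / z2" and "s = 1 / z2"
  have s0: "s \<noteq> 0" and ts: "t / s = z1 - z2" "1 / s = z2" "(1 + t) / s = z1"
    using z2 by (simp_all add: t_def s_def field_simps)
  have "norm t + norm (z * s) < 1" if "z \<in> set xs" for z
    using less[OF that] z2 by (simp add: t_def s_def norm_mult norm_divide field_simps)
  then have "(t, s) \<in> laurent_region (set xs)"
    using z12 z2 less' by (simp add: laurent_region_def t_def s_def norm_divide)
  then have sum: "abs_has_sum (\<lambda>l. e l * (t powi fst l * s powi snd l)) UNIV (H t s)"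
    using e by (auto simp: laurent_coeffs_def)
  \<comment> \<open>The new indices are the exponents of \<open>t\<close> and \<open>s\<close> in
    the iterate term, as z1 - z2 = t / s and z2 = 1 / s.\<close>
  have bij: "bij (\<lambda>(k1, k2). (- k1 - 1, k1 + k2 + 2 :: int))"
    by (rule o_bij[where g = "\<lambda>(k, N). (- k - 1, N + k - 1)"]) (auto simp: fun_eq_iff)
  have "H t s = pairing \<phi> (g zs)" using gp[OF zs_config] by (simp add: H_def ts zs_eq)
  moreover have "e (- k1 - 1, k1 + k2 + 2) * (t powi (- k1 - 1) * s powi (k1 + k2 + 2)) =
      pairing \<phi> (YL_iterate_series scaleW grW YV YL u1 u2 f zs (k1, k2))" for k1 k2
    using power_int_scale[OF s0, of t k1 "k1 + k2 + 2"]
    by (simp add: YL_iterate_series_def W.pairing_scale[OF \<phi>] zs_eq coeff ts mult_ac)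
  ultimately show "abs_has_sum (\<lambda>k. pairing \<phi> (YL_iterate_series scaleW grW YV YL u1 u2 f zs k)) UNIV
      (pairing \<phi> (g zs))"
    using abs_has_sum_reindex[OF bij, THEN iffD2, OF sum] by (simp add: case_prod_unfold)
qed

theorem corollary3p19:
  fixes scaleV :: "complex \<Rightarrow> 'v::ab_group_add \<Rightarrow> 'v" and grV :: "int \<Rightarrow> 'v set"
    and YV :: "'v \<Rightarrow> int \<Rightarrow> 'v \<Rightarrow> 'v" and vac :: 'v
    and scaleW :: "complex \<Rightarrow> 'w::ab_group_add \<Rightarrow> 'w" and grW :: "complex \<Rightarrow> 'w set"
    and DW :: "'w \<Rightarrow> 'w" and YL :: "'v \<Rightarrow> int \<Rightarrow> 'w \<Rightarrow> 'w" and YR :: "'w \<Rightarrow> int \<Rightarrow> 'v \<Rightarrow> 'w"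
    and n :: nat and u1 u2 :: 'v and f :: "complex list \<Rightarrow> complex \<Rightarrow> 'w"
  assumes "mosva scaleV grV YV vac"
    and "mosva_bimodule scaleV grV YV vac scaleW grW DW YL YR"
    and "pole_order_condition_algebra scaleV grV YV"
    and "pole_order_condition_bimodule YV scaleW grW YL YR"
    and "n \<ge> 1"
    and "f \<in> rational_maps scaleW grW n"
    and "\<exists>g. sum_extends_to scaleW grW (n + 2) (product_region n)
               (YL_product_series scaleW grW YL u1 u2 f) g"
  shows "(\<forall>zs\<in>iterate_region n. \<exists>s.
            completion_has_sum scaleW grW (YL_product_series scaleW grW YL u1 u2 f zs) s \<and>
            completion_has_sum scaleW grW (YL_iterate_series scaleW grW YV YL u1 u2 f zs) s) \<and>
         (\<exists>g. sum_extends_to scaleW grW (n + 2) (iterate_region n)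
                (YL_iterate_series scaleW grW YV YL u1 u2 f) g) \<and>
         rational_extension scaleW grW (n + 2) (product_region n)
           (YL_product_series scaleW grW YL u1 u2 f) \<in> rational_maps scaleW grW (n + 2) \<and>
         rational_extension scaleW grW (n + 2) (product_region n)
           (YL_product_series scaleW grW YL u1 u2 f) =
         rational_extension scaleW grW (n + 2) (iterate_region n)
           (YL_iterate_series scaleW grW YV YL u1 u2 f)"
proof -
  interpret mosva_bimodule scaleV grV YV vac scaleW grW DW YL YR by fact
  let ?P = "YL_product_series scaleW grW YL u1 u2 f" and ?I = "YL_iterate_series scaleW grW YV YL u1 u2 f"
  obtain g where g: "sum_extends_to scaleW grW (n + 2) (product_region n) ?P g" using assms(7) by blast
  \<comment> \<open>The map \<open>g\<close> that extends the product also extends the iterate, so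
    the two extensions coincide by uniqueness.\<close>
  have I: "sum_extends_to scaleW grW (n + 2) (iterate_region n) ?I g"
    using g iterate_series_converges[OF assms(5,6) g] by (simp add: sum_extends_to_def)
  have "rational_extension scaleW grW (n + 2) (product_region n) ?P = g"
    by (rule W.rational_extension_eqI[OF g iterate_region_subset])
  moreover have "rational_extension scaleW grW (n + 2) (iterate_region n) ?I = g"
    by (rule W.rational_extension_eqI[OF I order_refl])
  moreover have "completion_has_sum scaleW grW (?P zs) (g zs) \<and> completion_has_sum scaleW grW (?I zs) (g zs)"
    if "zs \<in> iterate_region n" for zs
    using that g I iterate_region_subset by (auto simp: sum_extends_to_def)
  ultimately show ?thesis using g I by (auto simp: sum_extends_to_def)
qed

end
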